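(* Let $G=(V,E)$ be a locally finite random geometric graph in $\mathbb{R}^2$ with stationary and ergodic law $\mathbb{P}$. Assume that (i) the law satisfies the polynomial mixing property $\mathrm{PM}_\xi$ and the polynomial long-edge property $\mathrm{PL}_\mu$ for some $\xi<0$ and $\mu<-2$; and (ii) the degree-measure intensity is finite, i.e. $$\theta_M=\mathbb{E}\Big[\sum_{v\in V\cap[0,1)^2}\deg_G(v)\Big]<\infty .$$ Then almost surely every connected component of $G$ is recurrent.
   Context: A random geometric graph $G=(V,E)$ in $\mathbb{R}^2$ is a random graph (possibly with marks attached to the vertices) with vertex set $V\subset\mathbb{R}^2$ and edge set $E$ consisting of unordered pairs of distinct elements of $V$. It is locally finite if, almost surely, $V\cap K$ is finite for every compact $K\subset\mathbb{R}^2$ and every vertex has finite graph degree. Stationary means that the law is invariant under translations of $\mathbb{R}^2$; ergodic means that translation-invariant events have probability $0$ or $1$. We write $x\sim y$ if $\{x,y\}\in E$, and $|\cdot|$ for the Euclidean norm. For $m>0$ and $z\in\mathbb{R}^2$ let $Q_m(z)=z+[-m/2,m/2)^2$. A box event $E$ assigns to each box $Q_m(z)$ an event $E(Q_m(z))$ (the events for boxes of the same size being translates of each other); it is local if $E(Q_m(z))$ is determined by the vertices, marks (if any), and internal edges (both endpoints in the box) of $Q_m(z)$. Property $\mathrm{PM}_\xi$: for every local box event $E$ there is a constant $C_E<\infty$ such that, for all sufficiently large $m$, $$\sup_{|z|>2}\operatorname{Cov}\big(\mathbf 1_{E(Q_m(0))},\mathbf 1_{E(Q_m(mz))}\big)\le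 C_E\,m^{\xi}.$$ Property $\mathrm{PL}_\mu$: for $L(m,n)=\{\exists\, x\sim y:\ x,y\in V\cap Q_m(0),\ |x-y|>n\}$, there are constants $C_L,n_0<\infty$ such that, for all $m\ge1$ and all $n\ge n_0$, $$\mathbb{P}(L(m,n))\le C_L\,m^2 n^{\mu}.$$ Graphs are regarded as electrical networks with unit conductances. A connected component is recurrent if the effective resistance from one (equivalently every) vertex of that component to infinity is infinite (equivalently, simple random walk on it is recurrent); finite components are recurrent by convention. *)

theory Defs
  imports "HOL-Probability.Probability"
begin

section \<open>Geometric graphs in the plane\<close>

type_synonym plane = "real^2"

text \<open>Only the values of \<open>mark\<close> on \<open>verts\<close> are meaningful. A graph without marks is the case
  in which \<open>'m\<close> is \<open>unit\<close>.\<close>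

record 'm geo_graph =
  verts :: "plane set"
  edges :: "plane set set"
  mark :: "plane \<Rightarrow> 'm"

definition valid_graph :: "'m measure \<Rightarrow> 'm geo_graph \<Rightarrow> bool" where
  "valid_graph K G \<longleftrightarrow>
     (\<forall>e\<in>edges G. \<exists>x\<in>verts G. \<exists>y\<in>verts G. x \<noteq> y \<and> e = {x, y}) \<and>
     (\<forall>v\<in>verts G. mark G v \<in> space K)"

definition adj :: "'m geo_graph \<Rightarrow> plane \<Rightarrow> plane \<Rightarrow> bool" where
  "adj G x y \<longleftrightarrow> {x, y} \<in> edges G"

definition neighbors :: "'m geo_graph \<Rightarrow> plane \<Rightarrow> plane set" where
  "neighbors G x = {y. adj G x y}"

text \<open>Number of elements with value \<open>\<infinity>\<close> (not \<open>0\<close>, as for \<^const>\<open>card\<close>) on infinite sets.\<close>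

definition ncard :: "'a set \<Rightarrow> ennreal" where
  "ncard A = emeasure (count_space UNIV) A"

definition deg :: "'m geo_graph \<Rightarrow> plane \<Rightarrow> ennreal" where
  "deg G x = ncard (neighbors G x)"

definition locally_finite :: "'m geo_graph \<Rightarrow> bool" where
  "locally_finite G \<longleftrightarrow>
     (\<forall>S. compact S \<longrightarrow> finite (verts G \<inter> S)) \<and> (\<forall>v\<in>verts G. finite (neighbors G v))"

definition translate :: "plane \<Rightarrow> 'm geo_graph \<Rightarrow> 'm geo_graph" where
  "translate t G =
     \<lparr> verts = (\<lambda>x. x + t) ` verts G,
       edges = (\<lambda>e. (\<lambda>x. x + t) ` e) ` edges G,
       mark = (\<lambda>x. mark G (x - t)) \<rparr>"

definition component :: "'m geo_graph \<Rightarrow> plane \<Rightarrow> plane set" where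
  "component G x = {y. (x, y) \<in> {(a, b). adj G a b}\<^sup>*}"

definition components_of :: "'m geo_graph \<Rightarrow> plane set set" where
  "components_of G = component G ` verts G"

section \<open>Random geometric graphs\<close>

definition vertex_count :: "plane set \<Rightarrow> 'm set \<Rightarrow> 'm geo_graph \<Rightarrow> ennreal" where
  "vertex_count A B G = ncard {v \<in> verts G. v \<in> A \<and> mark G v \<in> B}"

definition edge_count :: "plane set \<Rightarrow> plane set \<Rightarrow> 'm geo_graph \<Rightarrow> ennreal" where
  "edge_count A A' G = ncard {(x, y). adj G x y \<and> x \<in> A \<and> y \<in> A'}"

text \<open>The measurable space of graphs with marks in the measurable space \<open>K\<close> (of which only
  \<open>space\<close> and \<open>sets\<close> matter). As usual for point processes, the sigma-algebra is the one generated
  by the numbers of marked vertices and of (oriented) edges in measurable sets. It does not see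
  the values of \<open>mark\<close> outside \<open>verts\<close>.\<close>

definition graph_space :: "'m measure \<Rightarrow> 'm geo_graph measure" where
  "graph_space K = sigma {G. valid_graph K G}
     ({vertex_count A B -` S \<inter> {G. valid_graph K G} | A B S.
         A \<in> sets borel \<and> B \<in> sets K \<and> S \<in> sets borel} \<union>
      {edge_count A A' -` S \<inter> {G. valid_graph K G} | A A' S.
         A \<in> sets borel \<and> A' \<in> sets borel \<and> S \<in> sets borel})"

abbreviation law :: "'w measure \<Rightarrow> 'm measure \<Rightarrow> ('w \<Rightarrow> 'm geo_graph) \<Rightarrow> 'm geo_graph measure"
  where "law M K G \<equiv> distr M (graph_space K) G"

text \<open>In the following definitions \<open>P\<close> is a probability measure on \<open>graph_space K\<close>.\<close>

definition stationary :: "'m geo_graph measure \<Rightarrow> bool" where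
  "stationary P \<longleftrightarrow> (\<forall>t. distr P P (translate t) = P)"

definition translation_invariant :: "'m geo_graph measure \<Rightarrow> 'm geo_graph set \<Rightarrow> bool" where
  "translation_invariant P A \<longleftrightarrow>
     A \<in> sets P \<and> (\<forall>t. \<forall>G\<in>space P. translate t G \<in> A \<longleftrightarrow> G \<in> A)"

definition ergodic :: "'m geo_graph measure \<Rightarrow> bool" where
  "ergodic P \<longleftrightarrow>
     (\<forall>A. translation_invariant P A \<longrightarrow> measure P A = 0 \<or> measure P A = 1)"

definition covariance :: "'a measure \<Rightarrow> ('a \<Rightarrow> real) \<Rightarrow> ('a \<Rightarrow> real) \<Rightarrow> real" where
  "covariance P X Y =
     (\<integral>w. (X w - (\<integral>w'. X w' \<partial>P)) * (Y w - (\<integral>w'. Y w' \<partial>P)) \<partial>P)"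

section \<open>Box events, mixing and long edges\<close>

definition Q :: "real \<Rightarrow> plane \<Rightarrow> plane set" where
  "Q m z = {x. \<forall>i. z $ i - m / 2 \<le> x $ i \<and> x $ i < z $ i + m / 2}"

text \<open>A box event is given as a function on sets of points, of which only the values at boxes
  matter.\<close>

definition box_event :: "'m measure \<Rightarrow> (plane set \<Rightarrow> 'm geo_graph set) \<Rightarrow> bool" where
  "box_event K E \<longleftrightarrow>
     (\<forall>m>0. \<forall>z. E (Q m z) \<in> sets (graph_space K)) \<and>
     (\<forall>m>0. \<forall>z t. \<forall>G\<in>space (graph_space K).
        translate t G \<in> E (Q m (z + t)) \<longleftrightarrow> G \<in> E (Q m z))"

definition agree_on :: "plane set \<Rightarrow> 'm geo_graph \<Rightarrow> 'm geo_graph \<Rightarrow> bool" where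
  "agree_on B G H \<longleftrightarrow>
     verts G \<inter> B = verts H \<inter> B \<and>
     (\<forall>v\<in>verts G \<inter> B. mark G v = mark H v) \<and>
     {e \<in> edges G. e \<subseteq> B} = {e \<in> edges H. e \<subseteq> B}"

definition local_box_event :: "'m measure \<Rightarrow> (plane set \<Rightarrow> 'm geo_graph set) \<Rightarrow> bool" where
  "local_box_event K E \<longleftrightarrow> box_event K E \<and>
     (\<forall>m>0. \<forall>z. \<forall>G\<in>space (graph_space K). \<forall>H\<in>space (graph_space K).
        agree_on (Q m z) G H \<longrightarrow> (G \<in> E (Q m z) \<longleftrightarrow> H \<in> E (Q m z)))"

text \<open>The supremum over \<open>z\<close> is bounded by quantifying over all \<open>z\<close> with \<open>norm z > 2\<close>.\<close>

definition polynomial_mixing :: "'m measure \<Rightarrow> 'm geo_graph measure \<Rightarrow> real \<Rightarrow> bool" where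
  "polynomial_mixing K P \<xi> \<longleftrightarrow>
     (\<forall>E. local_box_event K E \<longrightarrow>
        (\<exists>C::real. \<forall>\<^sub>F m in at_top. \<forall>z. norm z > 2 \<longrightarrow>
           covariance P (indicator (E (Q m 0))) (indicator (E (Q m (m *\<^sub>R z)))) \<le> C * m powr \<xi>))"

definition long_edge_event :: "'m geo_graph measure \<Rightarrow> real \<Rightarrow> real \<Rightarrow> 'm geo_graph set" where
  "long_edge_event P m n =
     {G \<in> space P. \<exists>x\<in>verts G \<inter> Q m 0. \<exists>y\<in>verts G \<inter> Q m 0. adj G x y \<and> norm (x - y) > n}"

definition polynomial_long_edges :: "'m geo_graph measure \<Rightarrow> real \<Rightarrow> bool" where
  "polynomial_long_edges P \<mu> \<longleftrightarrow>
     (\<exists>C n\<^sub>0. n\<^sub>0 > 0 \<and> (\<forall>m\<ge>1. \<forall>n\<ge>n\<^sub>0.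
        measure P (long_edge_event P m n) \<le> C * m\<^sup>2 * n powr \<mu>))"

definition degree_intensity :: "'m geo_graph measure \<Rightarrow> ennreal" where
  "degree_intensity P =
     (\<integral>\<^sup>+G. (\<integral>\<^sup>+v. deg G v \<partial>count_space (verts G \<inter> {x. \<forall>i. 0 \<le> x $ i \<and> x $ i < 1})) \<partial>P)"

section \<open>Effective resistance and recurrence\<close>

text \<open>Unit conductances are placed on the edges and everything outside the finite set \<open>W\<close> is
  grounded. If a unit current is injected at \<open>a \<in> W\<close>, the voltage \<open>u\<close> is determined by Ohm's and
  Kirchhoff's laws, and the effective resistance between \<open>a\<close> and the complement of \<open>W\<close> is the
  potential difference \<open>u a - 0\<close>. When the component of \<open>a\<close> is infinite and locally finite and
  \<open>W\<close> is a finite subset of it, such a \<open>u\<close> exists and is unique.\<close>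

definition unit_current_voltage ::
    "'m geo_graph \<Rightarrow> plane \<Rightarrow> plane set \<Rightarrow> (plane \<Rightarrow> real) \<Rightarrow> bool" where
  "unit_current_voltage G a W u \<longleftrightarrow>
     (\<forall>x. x \<notin> W \<longrightarrow> u x = 0) \<and>
     (\<forall>x\<in>W. (\<Sum>y\<in>neighbors G x. u x - u y) = (if x = a then 1 else 0))"

definition eff_resistance_to_compl :: "'m geo_graph \<Rightarrow> plane \<Rightarrow> plane set \<Rightarrow> real" where
  "eff_resistance_to_compl G a W = (THE u. unit_current_voltage G a W u) a"

text \<open>The effective resistance to infinity is the limit of the effective resistances to the
  complements of the sets of a finite exhaustion of the component. These increase with the set
  (Rayleigh monotonicity), so the limit is the supremum over all finite sets.\<close>

definition eff_resistance_to_inf :: "'m geo_graph \<Rightarrow> plane \<Rightarrow> ereal" where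
  "eff_resistance_to_inf G a =
     (SUP W\<in>{W. finite W \<and> a \<in> W \<and> W \<subseteq> component G a}. ereal (eff_resistance_to_compl G a W))"

definition recurrent_component :: "'m geo_graph \<Rightarrow> plane set \<Rightarrow> bool" where
  "recurrent_component G C \<longleftrightarrow> finite C \<or> (\<forall>a\<in>C. eff_resistance_to_inf G a = \<infinity>)"

end

theory Submission
  imports Defs
begin

text \<open>The graph metric, with every edge of length one, serves as a test metric for the effective
  resistance across an annulus of size \<open>m\<close>. Its energy is the number of edges, which is \<open>O(m\<^sup>2)\<close> along
  a subsequence of scales because the degree intensity is finite (Fatou). If the graph distance across the
  annulus is at least a constant times \<open>m\<close>, the annulus therefore has resistance bounded below,
  and infinitely many disjoint annuli give an infinite resistance.

  The linear lower bound on the graph distance comes from a renormalization. A box is good if it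
  contains no edge comparable in length to its sub-boxes and if all its bad sub-boxes lie close to a
  single one of them. A walk crossing a good box then moves through good sub-boxes except for a
  detour of negligible size. Two far apart bad sub-boxes are almost independent by
  mixing, so the probability that a box is bad decays polynomially in its size.\<close>

section \<open>Energy and effective resistance\<close>

text \<open>Two opposite demands fix the scales. Each step costs a walk a fraction of its speed
  proportional to the inverse ratio of consecutive sides, so these inverses must be summable; the
  union bound over pairs of sub-boxes costs the fourth power of the ratio, which must stay
  subpolynomial in the side. Geometrically growing ratios satisfy both. Excluding every bad sub-box
  would be hopeless, since the union bound would then multiply the probability at each step; a pair
  instead produces its square, and the gain in the exponent pays for the number of pairs. Mixing
  says nothing about boxes at most two sides apart, hence the tolerance for a whole cluster. The
  long-edge assumption controls only edges inside a box, whereas a cutoff function could jump along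
  an edge that leaves it; such edges are excluded by dyadic boxes around the origin. Fatou gives
  infinitely many scales with few edges and Borel-Cantelli all large scales for the other
  conditions, so that infinitely many scales satisfy all of them.\<close>

text \<open>Gaussian elimination of one column at a time. Rows and columns are indexed by finite
  sets rather than types, so that both can be the vertex set of a finite part of a graph.\<close>

lemma linear_system_solvable:
  fixes A :: "'a \<Rightarrow> 'b \<Rightarrow> real"
  assumes "finite C" "finite R" "card R = card C"
    and "\<And>x. \<forall>i\<in>R. (\<Sum>j\<in>C. A i j * x j) = 0 \<Longrightarrow> \<forall>j\<in>C. x j = 0"
  shows "\<exists>x. \<forall>i\<in>R. (\<Sum>j\<in>C. A i j * x j) = b i"
  using assms
proof (induction C arbitrary: R A b rule: finite_induct)
  case empty
  then show ?case by simp
next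
  case (insert c C)
  note ker = insert.prems(3)
  have "\<exists>r\<in>R. A r c \<noteq> 0"
  proof (rule ccontr)
    assume "\<not> ?thesis"
    then have "\<forall>i\<in>R. (\<Sum>j\<in>insert c C. A i j * (if j = c then 1 else 0)) = 0"
      using insert.hyps by (auto intro!: sum.neutral)
    from ker[OF this] show False by simp
  qed
  then obtain r where r: "r \<in> R" "A r c \<noteq> 0" by blast
  \<comment> \<open>\<open>A'\<close> is the Schur complement of the pivot \<open>A r c\<close>, and
    \<open>ext s x\<close> back-substitutes the value at \<open>c\<close> that gives row
    \<open>r\<close> the right-hand side \<open>s\<close>.\<close>
  define A' where "A' i j = A i j - A i c / A r c * A r j" for i j
  define ext where "ext s x = x(c := (s - (\<Sum>j\<in>C. A r j * x j)) / A r c)" for s x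
  have sum_ext: "(\<Sum>j\<in>insert c C. A i j * ext s x j) = (\<Sum>j\<in>C. A' i j * x j) + A i c / A r c * s"
    for s x i
  proof -
    have eq: "(\<Sum>j\<in>C. A i j * ext s x j) = (\<Sum>j\<in>C. A i j * x j)"
      using insert.hyps by (intro sum.cong) (auto simp: ext_def)
    have "(\<Sum>j\<in>C. A' i j * x j) = (\<Sum>j\<in>C. A i j * x j) - A i c / A r c * (\<Sum>j\<in>C. A r j * x j)"
      by (simp add: A'_def left_diff_distrib sum_subtractf sum_distrib_left mult.assoc)
    then show ?thesis
      using insert.hyps eq by (simp add: ext_def diff_divide_distrib right_diff_distrib)
  qed
  have row_r: "(\<Sum>j\<in>C. A' r j * x j) = 0" for x
    using r by (simp add: A'_def)
  have "\<exists>x. \<forall>i\<in>R - {r}. (\<Sum>j\<in>C. A' i j * x j) = b i - A i c / A r c * b r"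
  proof (rule insert.IH)
    show "finite (R - {r})" "card (R - {r}) = card C"
      using insert.prems insert.hyps r by auto
    fix x assume x: "\<forall>i\<in>R - {r}. (\<Sum>j\<in>C. A' i j * x j) = 0"
    have "\<forall>i\<in>R. (\<Sum>j\<in>insert c C. A i j * ext 0 x j) = 0"
      unfolding sum_ext using x row_r by (metis add.right_neutral insert_Diff insert_iff mult_zero_right r(1))
    from ker[OF this] show "\<forall>j\<in>C. x j = 0"
      using insert.hyps by (auto simp: ext_def split: if_splits)
  qed
  then obtain x where x: "\<forall>i\<in>R - {r}. (\<Sum>j\<in>C. A' i j * x j) = b i - A i c / A r c * b r" by blast
  have "(\<Sum>j\<in>insert c C. A i j * ext (b r) x j) = b i" if "i \<in> R" for i
    unfolding sum_ext using x row_r that r by (cases "i = r") auto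
  then show ?case by blast
qed

lemma adj_sym: "adj G x y \<longleftrightarrow> adj G y x"
  by (simp add: adj_def insert_commute)

lemma adj_in_component: "x \<in> component G a \<Longrightarrow> adj G x y \<Longrightarrow> y \<in> component G a"
  unfolding component_def by (auto intro: rtrancl_into_rtrancl)

lemma self_in_component: "a \<in> component G a"
  by (simp add: component_def)

lemma component_eq:
  assumes "a \<in> component G x"
  shows "component G a = component G x"
proof -
  let ?r = "{(a, b). adj G a b}"
  have "sym (?r\<^sup>*)"
    by (intro sym_rtrancl symI) (auto simp: adj_sym)
  then have "(a, x) \<in> ?r\<^sup>*" "(x, a) \<in> ?r\<^sup>*"
    using assms by (auto simp: component_def dest: symD)
  then show ?thesis
    by (auto simp: component_def intro: rtrancl_trans)
qed

text \<open>Every undirected edge is counted twice, hence the factor 2 in \<open>summation_by_parts\<close>.\<close>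

definition nbhd_edges :: "'m geo_graph \<Rightarrow> plane set \<Rightarrow> (plane \<times> plane) set" where
  "nbhd_edges G W = {(x, y). adj G x y \<and> (x \<in> W \<or> y \<in> W)}"

lemma finite_nbhd_edges:
  assumes "finite W" "\<And>x. x \<in> W \<Longrightarrow> finite (neighbors G x)"
  shows "finite (nbhd_edges G W)"
proof -
  let ?F = "Sigma W (neighbors G)"
  have "finite ?F" using assms by blast
  moreover have "nbhd_edges G W \<subseteq> ?F \<union> prod.swap ` ?F"
    by (force simp: nbhd_edges_def neighbors_def adj_sym)
  ultimately show ?thesis by (meson finite_Un finite_imageI finite_subset)
qed

text \<open>Discrete Green formula. Reversing oriented edges turns the \<open>f y\<close> part into
  minus the \<open>f x\<close> part, and edges starting outside \<open>W\<close> contribute nothing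
  to the latter. Vanishing is required only at outer neighbours of \<open>W\<close>, because the
  cutoff functions may be nonzero in other components.\<close>

lemma summation_by_parts:
  assumes W: "finite W" "\<And>x. x \<in> W \<Longrightarrow> finite (neighbors G x)"
    and f: "\<And>x y. x \<in> W \<Longrightarrow> adj G x y \<Longrightarrow> y \<notin> W \<Longrightarrow> f y = (0::real)"
  shows "(\<Sum>(x, y)\<in>nbhd_edges G W. (u x - u y) * (f x - f y)) =
    2 * (\<Sum>x\<in>W. f x * (\<Sum>y\<in>neighbors G x. u x - u y))"
proof -
  let ?N = "nbhd_edges G W" and ?F = "Sigma W (neighbors G)"
  let ?g = "\<lambda>(x, y). (u x - u y) * f x" and ?h = "\<lambda>(x, y). (u x - u y) * f y"
  have fin: "finite ?N" using W by (rule finite_nbhd_edges)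
  have F: "?F \<subseteq> ?N" by (auto simp: nbhd_edges_def neighbors_def)
  have "sum ?g ?N = sum ?g ?F"
  proof (rule sum.mono_neutral_right[OF fin F], rule ballI)
    fix e assume "e \<in> ?N - ?F"
    then obtain x y where "e = (x, y)" "y \<in> W" "adj G y x" "x \<notin> W"
      by (auto simp: nbhd_edges_def neighbors_def adj_sym)
    then show "?g e = 0" using f by simp
  qed
  also have "\<dots> = (\<Sum>x\<in>W. f x * (\<Sum>y\<in>neighbors G x. u x - u y))"
    using W by (subst sum.Sigma[symmetric]) (auto simp: sum_distrib_left mult.commute)
  finally have g: "sum ?g ?N = \<dots>" .
  have "sum ?h ?N = sum (\<lambda>(x, y). - ((u x - u y) * f x)) ?N"
    by (rule sum.reindex_bij_witness[of _ prod.swap prod.swap])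
      (auto simp: nbhd_edges_def adj_sym algebra_simps)
  also have "\<dots> = - sum ?g ?N" by (simp add: sum_negf split_def)
  finally have h: "sum ?h ?N = - sum ?g ?N" .
  have "(\<Sum>(x, y)\<in>?N. (u x - u y) * (f x - f y)) = sum ?g ?N - sum ?h ?N"
    by (simp add: sum_subtractf[symmetric] split_def algebra_simps)
  then show ?thesis using g h by simp
qed

text \<open>The Dirichlet energy of \<open>u\<close> vanishes, so \<open>u\<close> is constant on
  the component. A finite \<open>W\<close> cannot exhaust an infinite component, and
  \<open>u\<close> is zero at the points left over.\<close>

lemma grounded_laplacian_injective:
  assumes W: "finite W" "W \<subseteq> component G a" "\<And>x. x \<in> W \<Longrightarrow> finite (neighbors G x)"
    and inf: "infinite (component G a)"
    and u: "\<And>x. x \<notin> W \<Longrightarrow> u x = (0::real)" "\<And>x. x \<in> W \<Longrightarrow> (\<Sum>y\<in>neighbors G x. u x - u y) = 0"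
  shows "u x = 0"
proof (cases "x \<in> W")
  case True
  have "(\<Sum>(x, y)\<in>nbhd_edges G W. (u x - u y) * (u x - u y)) = 0"
    using u by (subst summation_by_parts[OF W(1,3)]) auto
  then have "\<forall>e\<in>nbhd_edges G W. (case e of (x, y) \<Rightarrow> (u x - u y) * (u x - u y)) = 0"
    by (subst (asm) sum_nonneg_eq_0_iff) (auto simp: finite_nbhd_edges W)
  then have const: "u x = u y" if "adj G x y" for x y
    using that u(1) by (cases "x \<in> W \<or> y \<in> W") (auto simp: nbhd_edges_def)
  have "u y = u a" if "y \<in> component G a" for y
  proof -
    from that have "(a, y) \<in> {(a, b). adj G a b}\<^sup>*" by (simp add: component_def)
    then show ?thesis by induction (use const in auto)
  qed
  moreover obtain y where "y \<in> component G a" "y \<notin> W"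
    using inf W(1) by (meson finite_subset subsetI)
  ultimately show ?thesis using u(1)[of y] True W(2) by auto
qed (use u in auto)

text \<open>Makes the definite description in \<open>eff_resistance_to_compl\<close> meaningful.
  Injectivity of the grounded Laplacian gives uniqueness and, the system being square, also
  existence.\<close>

lemma unit_current_voltage_exists_unique:
  assumes W: "finite W" "W \<subseteq> component G a" "\<And>x. x \<in> W \<Longrightarrow> finite (neighbors G x)"
    and inf: "infinite (component G a)"
  shows "\<exists>!u. unit_current_voltage G a W u"
proof -
  \<comment> \<open>\<open>L\<close> is the matrix of the Laplacian on \<open>W\<close> with zero
    boundary values; \<open>cut\<close> extends a vector on \<open>W\<close> by zero.\<close>
  define L where "L x y = (if x = y then real (card (neighbors G x)) else 0)
      - (if y \<in> neighbors G x then 1 else 0)" for x y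
  define cut where "cut u x = (if x \<in> W then u x else 0)" for u :: "plane \<Rightarrow> real" and x
  have L: "(\<Sum>y\<in>W. L x y * u y) = (\<Sum>y\<in>neighbors G x. cut u x - cut u y)" if "x \<in> W" for u x
  proof -
    have "(\<Sum>y\<in>neighbors G x. cut u y) = (\<Sum>y\<in>neighbors G x \<inter> W. u y)"
      using W(3)[OF that] by (simp add: cut_def sum.inter_restrict)
    also have "\<dots> = (\<Sum>y\<in>W. if y \<in> neighbors G x then u y else 0)"
      using W(1) by (subst Int_commute) (simp add: sum.inter_restrict)
    moreover have "(\<Sum>y\<in>W. L x y * u y) = (\<Sum>y\<in>W. (if x = y then real (card (neighbors G x)) * u y else 0))
        - (\<Sum>y\<in>W. if y \<in> neighbors G x then u y else 0)"
      unfolding sum_subtractf[symmetric] by (intro sum.cong) (auto simp: L_def algebra_simps)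
    ultimately show ?thesis
      using that W(1) by (simp add: sum_subtractf cut_def)
  qed
  have ker: "\<forall>y\<in>W. u y = 0" if "\<forall>x\<in>W. (\<Sum>y\<in>W. L x y * u y) = 0" for u
  proof -
    have "cut u y = 0" for y
      by (rule grounded_laplacian_injective[OF W inf, where u = "cut u"]) (use that L in \<open>auto simp: cut_def\<close>)
    then show ?thesis unfolding cut_def by metis
  qed
  obtain u where "\<forall>x\<in>W. (\<Sum>y\<in>W. L x y * u y) = (if x = a then 1 else 0)"
    using linear_system_solvable[where A = L and b = "\<lambda>x. if x = a then 1 else 0", OF W(1,1) refl] ker by blast
  then have "unit_current_voltage G a W (cut u)"
    using L by (auto simp: unit_current_voltage_def cut_def)
  moreover have "u = v" if "unit_current_voltage G a W u" "unit_current_voltage G a W v" for u v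
  proof
    fix x
    have "u x - v x = 0"
    proof (rule grounded_laplacian_injective[OF W inf, where u = "\<lambda>x. u x - v x"])
      fix x assume "x \<in> W"
      have "(\<Sum>y\<in>neighbors G x. (u x - v x) - (u y - v y)) =
          (\<Sum>y\<in>neighbors G x. u x - u y) - (\<Sum>y\<in>neighbors G x. v x - v y)"
        by (subst sum_subtractf[symmetric]) (simp add: algebra_simps)
      also have "\<dots> = 0"
        using that \<open>x \<in> W\<close> unfolding unit_current_voltage_def by (metis diff_self)
      finally show "(\<Sum>y\<in>neighbors G x. (u x - v x) - (u y - v y)) = 0" .
    qed (use that in \<open>auto simp: unit_current_voltage_def\<close>)
    then show "u x = v x" by simp
  qed
  ultimately show ?thesis by blast
qed

text \<open>If the potential is \<open>u\<close>, then \<open>u a\<close> is its Dirichlet energy, and by the Cauchy-Schwarz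
  inequality every cutoff function \<open>f n\<close> forces a fixed amount of energy on the edges on
  which \<open>f n\<close> is not constant.\<close>

lemma eff_resistance_to_inf_eq_infinity:
  fixes f :: "nat \<Rightarrow> plane \<Rightarrow> real"
  assumes fin: "\<And>x. x \<in> component G a \<Longrightarrow> finite (neighbors G x)"
    and inf: "infinite (component G a)"
    and I: "infinite I"
    and f_a: "\<And>n. n \<in> I \<Longrightarrow> f n a = 1"
    and supp: "\<And>n. n \<in> I \<Longrightarrow> finite {x \<in> component G a. f n x \<noteq> 0}"
    and fin_D: "\<And>n. n \<in> I \<Longrightarrow> finite {(x, y). adj G x y \<and> f n x \<noteq> f n y}"
    and energy: "\<And>n. n \<in> I \<Longrightarrow> (\<Sum>(x, y)\<in>{(x, y). adj G x y \<and> f n x \<noteq> f n y}. (f n x - f n y)\<^sup>2) \<le> B"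
    and disj: "\<And>n n'. n \<in> I \<Longrightarrow> n' \<in> I \<Longrightarrow> n \<noteq> n' \<Longrightarrow>
      {(x, y). adj G x y \<and> f n x \<noteq> f n y} \<inter> {(x, y). adj G x y \<and> f n' x \<noteq> f n' y} = {}"
  shows "eff_resistance_to_inf G a = \<infinity>"
proof -
  define B' where "B' = max B 1"
  have B': "B' > 0" "B \<le> B'" by (auto simp: B'_def)
  have "\<exists>W. finite W \<and> a \<in> W \<and> W \<subseteq> component G a \<and> real N \<le> eff_resistance_to_compl G a W * B'" for N
  proof -
    obtain J where J: "J \<subseteq> I" "card J = N" "finite J"
      using infinite_arbitrarily_large[OF I] by blast
    \<comment> \<open>\<open>W\<close> contains the supports of \<open>N\<close> cutoff functions
      within the component, so that each of them vanishes at the outer neighbours of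
      \<open>W\<close> and can be used in the summation by parts.\<close>
    define W where "W = insert a (\<Union>n\<in>J. {x \<in> component G a. f n x \<noteq> 0})"
    have W: "finite W" "W \<subseteq> component G a" "a \<in> W"
      using J supp by (auto simp: W_def self_in_component)
    then have finW: "\<And>x. x \<in> W \<Longrightarrow> finite (neighbors G x)" using fin by auto
    define u where "u = (THE u. unit_current_voltage G a W u)"
    have u: "unit_current_voltage G a W u"
      unfolding u_def by (rule theI'[OF unit_current_voltage_exists_unique[OF W(1,2) finW inf]])
    let ?E = "nbhd_edges G W"
    let ?D = "\<lambda>n. {(x, y). adj G x y \<and> f n x \<noteq> f n y} \<inter> ?E"
    let ?du = "\<lambda>(x, y). u x - u y"
    have finE: "finite ?E" using W finW by (blast intro: finite_nbhd_edges)
    have "(\<Sum>(x, y)\<in>?E. (u x - u y) * (u x - u y)) = 2 * (\<Sum>x\<in>W. u x * (if x = a then 1 else 0))"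
      using u by (subst summation_by_parts[OF W(1) finW])
        (auto simp: unit_current_voltage_def intro!: sum.cong)
    then have uu: "(\<Sum>e\<in>?E. (?du e)\<^sup>2) = 2 * u a"
      using W by (simp add: split_def power2_eq_square if_distrib cong: if_cong)
    \<comment> \<open>Testing the unit current against \<open>f n\<close> gives 2, as every edge
      counts in both orientations; the 4 is its square in the Cauchy-Schwarz inequality.\<close>
    have low: "4 / B' \<le> (\<Sum>e\<in>?D n. (?du e)\<^sup>2)" if n: "n \<in> J" for n
    proof -
      let ?df = "\<lambda>(x, y). f n x - f n y"
      have nI: "n \<in> I" using n J by auto
      have "(\<Sum>(x, y)\<in>?E. (u x - u y) * (f n x - f n y)) = 2 * (\<Sum>x\<in>W. f n x * (if x = a then 1 else 0))"
      proof (subst summation_by_parts[OF W(1) finW])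
        fix x y assume "x \<in> W" "adj G x y" "y \<notin> W"
        then have "y \<in> component G a" "y \<notin> W" using W adj_in_component by blast+
        then show "f n y = 0" using n by (auto simp: W_def)
      qed (use u in \<open>auto simp: unit_current_voltage_def intro!: sum.cong\<close>)
      also have "\<dots> = 2" using W f_a[OF nI] by (simp add: if_distrib cong: if_cong)
      also have "(\<Sum>(x, y)\<in>?E. (u x - u y) * (f n x - f n y)) = (\<Sum>e\<in>?D n. ?du e * ?df e)"
        using finE by (intro sum.mono_neutral_cong_right) (auto simp: nbhd_edges_def)
      finally have "4 = (\<Sum>e\<in>?D n. ?du e * ?df e)\<^sup>2" by simp
      also have "\<dots> \<le> (\<Sum>e\<in>?D n. (?du e)\<^sup>2) * (\<Sum>e\<in>?D n. (?df e)\<^sup>2)"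
        by (rule Cauchy_Schwarz_ineq_sum)
      finally have cs: "4 \<le> (\<Sum>e\<in>?D n. (?du e)\<^sup>2) * (\<Sum>e\<in>?D n. (?df e)\<^sup>2)" .
      have "(\<Sum>e\<in>?D n. (?df e)\<^sup>2) \<le> (\<Sum>e\<in>{(x, y). adj G x y \<and> f n x \<noteq> f n y}. (?df e)\<^sup>2)"
        by (rule sum_mono2[OF fin_D[OF nI]]) auto
      also have "\<dots> \<le> B'"
        using energy[OF nI] B' by (simp add: split_def)
      finally have "4 \<le> (\<Sum>e\<in>?D n. (?du e)\<^sup>2) * B'"
        by (intro order_trans[OF cs] mult_left_mono sum_nonneg) auto
      then show ?thesis
        using B' by (simp add: field_simps)
    qed
    have "real N * (4 / B') = (\<Sum>n\<in>J. 4 / B')" using J by simp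
    also have "\<dots> \<le> (\<Sum>n\<in>J. \<Sum>e\<in>?D n. (?du e)\<^sup>2)" by (intro sum_mono low)
    also have "\<dots> = (\<Sum>e\<in>(\<Union>n\<in>J. ?D n). (?du e)\<^sup>2)"
    proof (intro sum.UNION_disjoint[symmetric] ballI impI)
      fix n n' assume "n \<in> J" "n' \<in> J" "n \<noteq> n'"
      then show "?D n \<inter> ?D n' = {}" using disj[of n n'] J by blast
    qed (use J finE in auto)
    also have "\<dots> \<le> (\<Sum>e\<in>?E. (?du e)\<^sup>2)"
      using finE by (intro sum_mono2) auto
    also have "\<dots> = 2 * u a" by (rule uu)
    finally have "2 * real N \<le> u a * B'" using B' by (simp add: field_simps)
    then have "real N \<le> eff_resistance_to_compl G a W * B'"
      unfolding eff_resistance_to_compl_def u_def by linarith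
    then show ?thesis using W by blast
  qed
  then have *: "\<exists>W. finite W \<and> a \<in> W \<and> W \<subseteq> component G a \<and> real N / B' \<le> eff_resistance_to_compl G a W" for N
    using B' by (simp add: field_simps)
  show ?thesis
  proof (rule ereal_top)
    fix r :: real
    obtain N where "r * B' \<le> real N" using real_arch_simple by blast
    then have "r \<le> real N / B'" using B' by (simp add: field_simps)
    with * obtain W where "W \<in> {W. finite W \<and> a \<in> W \<and> W \<subseteq> component G a}"
      "r \<le> eff_resistance_to_compl G a W" by (metis (mono_tags, lifting) mem_Collect_eq order_trans)
    then show "ereal r \<le> eff_resistance_to_inf G a"
      unfolding eff_resistance_to_inf_def by (auto intro!: SUP_upper2)
  qed
qed

section \<open>Walks, boxes and good scales\<close>

definition walk :: "'m geo_graph \<Rightarrow> plane set \<Rightarrow> nat \<Rightarrow> (nat \<Rightarrow> plane) \<Rightarrow> bool" where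
  "walk G S k p \<longleftrightarrow> (\<forall>l<k. adj G (p l) (p (Suc l))) \<and> (\<forall>l\<le>k. p l \<in> S)"

definition long_edge :: "plane set \<Rightarrow> real \<Rightarrow> 'm geo_graph \<Rightarrow> bool" where
  "long_edge S r G \<longleftrightarrow> (\<exists>x\<in>S. \<exists>y\<in>S. adj G x y \<and> norm (x - y) > r)"

lemma walk_sub:
  "walk G S k p \<Longrightarrow> j + l \<le> k \<Longrightarrow> walk G S l (\<lambda>i. p (j + i))"
  by (simp add: walk_def)

lemma walk_mono: "walk G S k p \<Longrightarrow> (\<And>l. l \<le> k \<Longrightarrow> p l \<in> T) \<Longrightarrow> walk G T k p"
  by (simp add: walk_def)

lemma walk_edge_le:
  assumes "walk G S k p" "\<not> long_edge S r G" "l < k"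
  shows "norm (p (Suc l) - p l) \<le> r"
  using assms unfolding walk_def long_edge_def
  by (metis Suc_leI less_or_eq_imp_le linorder_not_le norm_minus_commute)

lemma walk_displacement_le:
  assumes "walk G S k p" "\<not> long_edge S r G"
  shows "norm (p k - p 0) \<le> real k * r"
proof -
  have "l \<le> k \<Longrightarrow> norm (p l - p 0) \<le> real l * r" for l
  proof (induction l)
    case (Suc l)
    have "norm (p (Suc l) - p 0) \<le> norm (p (Suc l) - p l) + norm (p l - p 0)"
      by (metis diff_add_cancel add_diff_eq norm_triangle_ineq)
    then show ?case
      using Suc walk_edge_le[OF assms, of l] by (simp add: algebra_simps)
  qed auto
  then show ?thesis by blast
qed

text \<open>Greedy decomposition into pieces of displacement at least \<open>m / 8\<close>.\<close>

lemma walk_length_local: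
  fixes m \<eta> r :: real
  assumes "\<eta> \<ge> 0" "m > 0" "r \<le> m / 8" "\<not> long_edge S r G"
    and loc: "\<And>k p. walk G S k p \<Longrightarrow> (\<And>l. l \<le> k \<Longrightarrow> norm (p l - p 0) \<le> m / 4) \<Longrightarrow>
      p 0 \<in> U \<Longrightarrow> norm (p k - p 0) \<ge> m / 8 \<Longrightarrow> real k \<ge> \<eta> * norm (p k - p 0)"
    and w: "walk G S k p" "\<And>l. l \<le> k \<Longrightarrow> p l \<in> U"
  shows "real k \<ge> \<eta> * (norm (p k - p 0) - m / 8)"
  using w
proof (induction k arbitrary: p rule: less_induct)
  case (less k)
  show ?case
  proof (cases "norm (p k - p 0) < m / 8")
    case True
    then have "\<eta> * (norm (p k - p 0) - m / 8) \<le> 0"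
      using \<open>\<eta> \<ge> 0\<close> by (simp add: mult_nonneg_nonpos)
    then show ?thesis by (meson of_nat_0_le_iff order_trans)
  next
    case False
    define j where "j = (LEAST j. norm (p j - p 0) \<ge> m / 8)"
    have j: "norm (p j - p 0) \<ge> m / 8" "j \<le> k"
      using False LeastI[of "\<lambda>j. norm (p j - p 0) \<ge> m / 8" k] Least_le[of "\<lambda>j. norm (p j - p 0) \<ge> m / 8" k]
      unfolding j_def by auto
    have below: "norm (p l - p 0) < m / 8" if "l < j" for l
      using not_less_Least[of l "\<lambda>j. norm (p j - p 0) \<ge> m / 8"] that unfolding j_def by simp
    from j(1) \<open>m > 0\<close> have "j \<noteq> 0" by (intro notI) simp
    then obtain i where i: "j = Suc i" using not0_implies_Suc by blast
    \<comment> \<open>The first exit from radius \<open>m / 8\<close> overshoots by at most one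
      edge, of length at most \<open>r\<close>, so the piece remains within the radius
      \<open>m / 4\<close> that \<open>loc\<close> demands.\<close>
    have "norm (p j - p 0) \<le> norm (p (Suc i) - p i) + norm (p i - p 0)"
      unfolding i by (metis diff_add_cancel add_diff_eq norm_triangle_ineq)
    also have "\<dots> \<le> m / 4"
      using walk_edge_le[OF less.prems(1) assms(4), of i] below[of i] i j(2) assms(3) by simp
    finally have top: "norm (p j - p 0) \<le> m / 4" .
    have "real j \<ge> \<eta> * norm (p j - p 0)"
    proof (rule loc)
      show "walk G S j p" using less.prems(1) j(2) by (simp add: walk_def)
      show "norm (p l - p 0) \<le> m / 4" if "l \<le> j" for l
        using that below[of l] top \<open>m > 0\<close> by (cases "l = j") auto
    qed (use less.prems j in auto)
    moreover have "real (k - j) \<ge> \<eta> * (norm (p (j + (k - j)) - p (j + 0)) - m / 8)"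
      by (rule less.IH[where p = "\<lambda>i. p (j + i)"])
        (use less.prems j \<open>j \<noteq> 0\<close> in \<open>auto intro: walk_sub\<close>)
    moreover have "norm (p k - p 0) \<le> norm (p k - p j) + norm (p j - p 0)"
      by (metis diff_add_cancel add_diff_eq norm_triangle_ineq)
    then have "\<eta> * (norm (p k - p 0) - m / 8) \<le> \<eta> * ((norm (p k - p j) - m / 8) + norm (p j - p 0))"
      using \<open>\<eta> \<ge> 0\<close> by (intro mult_left_mono) auto
    then have "\<eta> * (norm (p k - p 0) - m / 8) \<le> \<eta> * (norm (p k - p j) - m / 8) + \<eta> * norm (p j - p 0)"
      by (simp only: distrib_left)
    ultimately show ?thesis using j(2) by (simp add: of_nat_diff)
  qed
qed

text \<open>The walk is cut at its first and its last visit to the exceptional ball.\<close>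

lemma walk_length_exceptional_ball:
  fixes m \<eta> r :: real
  assumes "\<eta> \<ge> 0" "m > 0" "r \<le> m / 8" "\<not> long_edge S r G"
    and loc: "\<And>k p. walk G S k p \<Longrightarrow> (\<And>l. l \<le> k \<Longrightarrow> norm (p l - p 0) \<le> m / 4) \<Longrightarrow>
      p 0 \<notin> cball c (3 * m) \<Longrightarrow> norm (p k - p 0) \<ge> m / 8 \<Longrightarrow> real k \<ge> \<eta> * norm (p k - p 0)"
    and w: "walk G S k p"
  shows "real k \<ge> \<eta> * (norm (p k - p 0) - 7 * m)"
proof -
  let ?D = "cball c (3 * m)"
  have tri: "norm (u - v) \<le> norm (u - x) + norm (x - v)" for u v x :: plane
    by (metis diff_add_cancel add_diff_eq norm_triangle_ineq)
  have avoid: "real j \<ge> \<eta> * (norm (q j - q 0) - m / 8)" if "walk G S j q" "\<And>l. l \<le> j \<Longrightarrow> q l \<notin> ?D" for j q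
    by (rule walk_length_local[OF assms(1-4), where U = "- ?D"]) (use that loc in auto)
  show ?thesis
  proof (cases "\<exists>l\<le>k. p l \<in> ?D")
    case False
    then have "real k \<ge> \<eta> * (norm (p k - p 0) - m / 8)"
      using avoid w by blast
    moreover have "\<eta> * (norm (p k - p 0) - 7 * m) \<le> \<eta> * (norm (p k - p 0) - m / 8)"
      using assms by (intro mult_left_mono) auto
    ultimately show ?thesis by linarith
  next
    case True
    define i where "i = (LEAST l. l \<le> k \<and> p l \<in> ?D)"
    define j where "j = Max {l. l \<le> k \<and> p l \<in> ?D}"
    have i: "i \<le> k" "p i \<in> ?D"
      using LeastI_ex[OF True] unfolding i_def by auto
    have i_min: "p l \<notin> ?D" if "l < i" for l
      using not_less_Least[of l "\<lambda>l. l \<le> k \<and> p l \<in> ?D"] that i unfolding i_def by auto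
    have fin: "finite {l. l \<le> k \<and> p l \<in> ?D}" by simp
    have j: "j \<le> k" "p j \<in> ?D"
      using Max_in[OF fin] True unfolding j_def by auto
    have j_max: "p l \<notin> ?D" if "j < l" "l \<le> k" for l
    proof
      assume "p l \<in> ?D"
      then have "l \<le> j" unfolding j_def using that by (intro Max_ge fin) auto
      then show False using that by simp
    qed
    have ij: "i \<le> j" using i_min[of j] j by (meson not_le)
    \<comment> \<open>The edge into the ball is left out, since \<open>avoid\<close> needs a walk
      outside the ball. It costs at most another \<open>m / 8\<close>, hence the
      \<open>m / 4\<close>.\<close>
    have first: "real i \<ge> \<eta> * (norm (p i - p 0) - m / 4)"
    proof (cases i)
      case (Suc i')
      have "real i' \<ge> \<eta> * (norm (p i' - p 0) - m / 8)"
        using w i Suc i_min by (intro avoid) (auto simp: walk_def)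
      moreover have "norm (p i - p 0) - m / 4 \<le> norm (p i' - p 0) - m / 8"
        using tri[of "p i" "p 0" "p i'"] walk_edge_le[OF w assms(4), of i'] Suc i assms(3) by simp
      ultimately show ?thesis
        using mult_left_mono[OF _ assms(1)] Suc by (smt (verit) of_nat_Suc)
    qed (use assms in \<open>simp add: mult_nonneg_nonpos\<close>)
    have last: "real (k - j) \<ge> \<eta> * (norm (p k - p j) - m / 4)"
    proof (cases "j = k")
      case False
      have "real (k - Suc j) \<ge> \<eta> * (norm (p (Suc j + (k - Suc j)) - p (Suc j + 0)) - m / 8)"
        using w j j_max False by (intro avoid[where q = "\<lambda>l. p (Suc j + l)"] walk_sub) auto
      moreover have "norm (p k - p j) - m / 4 \<le> norm (p k - p (Suc j)) - m / 8"
        using tri[of "p k" "p j" "p (Suc j)"] walk_edge_le[OF w assms(4), of j] False j assms(3) by simp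
      ultimately show ?thesis
        using mult_left_mono[OF _ assms(1), of "norm (p k - p j) - m / 4" "norm (p k - p (Suc j)) - m / 8"] j False
        by simp
    qed (use assms in \<open>simp add: mult_nonneg_nonpos\<close>)
    \<comment> \<open>The ball has diameter \<open>6 * m\<close>; with \<open>m / 4\<close> lost
      before and after it, the total loss stays below \<open>7 * m\<close>.\<close>
    have "norm (p j - p i) \<le> 6 * m"
      using i j dist_triangle2[of "p j" "p i" c] unfolding dist_norm[symmetric] mem_cball
      by (simp add: dist_commute)
    then have "norm (p k - p 0) - 7 * m \<le> (norm (p i - p 0) - m / 4) + (norm (p k - p j) - m / 4)"
      using tri[of "p k" "p 0" "p j"] tri[of "p j" "p 0" "p i"] assms(2) by simp
    then have "\<eta> * (norm (p k - p 0) - 7 * m) \<le> \<eta> * (norm (p i - p 0) - m / 4) + \<eta> * (norm (p k - p j) - m / 4)"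
      using mult_left_mono[OF _ assms(1)] by (metis distrib_left)
    also have "\<dots> \<le> real i + real (k - j)" using first last by simp
    also have "\<dots> \<le> real k" using ij j by simp
    finally show ?thesis .
  qed
qed

text \<open>The growth factors \<open>2 ^ (n + 8)\<close> are chosen such that their inverses are summable and small:
  the fraction of the walk speed lost in the step to the next side is at most \<open>56 / 2 ^ (n + 8)\<close>.
  Different values of the parameter \<open>i\<close> give disjoint sets of scales. A single
  box event can thus encode all the renormalization schemes, whose mixing constant is then
  independent of \<open>i\<close>.\<close>

primrec side_exp :: "nat \<Rightarrow> nat" where
  "side_exp 0 = 0"
| "side_exp (Suc n) = side_exp n + (n + 8)"

definition side :: "nat \<Rightarrow> nat \<Rightarrow> real" where
  "side i n = 3 ^ i * 2 ^ side_exp n"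

lemma side_Suc: "side i (Suc n) = 2 ^ (n + 8) * side i n"
  by (simp add: side_def power_add)

lemma side_pos: "side i n > 0"
  by (simp add: side_def)

lemma side_ge_1: "side i n \<ge> 1"
  unfolding side_def using mult_mono[of 1 "3 ^ i" 1 "2 ^ side_exp n :: real"] by simp

lemma strict_mono_side_exp: "strict_mono side_exp"
  by (rule strict_monoI_Suc) simp

text \<open>Unique factorization. It allows \<open>renorm_event\<close> to decode both the scheme
  and the scale from the side of a box.\<close>

lemma side_eq_iff: "side i n = side j k \<longleftrightarrow> i = j \<and> n = k"
proof
  assume "side i n = side j k"
  then have "real (3 ^ i * 2 ^ side_exp n) = real (3 ^ j * 2 ^ side_exp k)"
    by (simp add: side_def)
  then have eq: "3 ^ i * 2 ^ side_exp n = (3 ^ j * 2 ^ side_exp k :: nat)"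
    using of_nat_eq_iff by blast
  have aux: "b \<le> a" if "3 ^ i * 2 ^ a = (3 ^ j * 2 ^ b :: nat)" for a b i j :: nat
  proof -
    have "coprime (2 ^ b) (3 ^ i :: nat)" by simp
    moreover have "2 ^ b dvd (3 ^ i * 2 ^ a :: nat)" using that by simp
    ultimately have "2 ^ b dvd (2 ^ a :: nat)" by (metis coprime_dvd_mult_right_iff)
    then show ?thesis by (simp add: dvd_power_iff_le)
  qed
  have "side_exp n = side_exp k" using aux[OF eq] aux[OF eq[symmetric]] by simp
  moreover from this eq have "i = j" by simp
  ultimately show "i = j \<and> n = k" using strict_mono_eq[OF strict_mono_side_exp] by blast
qed auto

section \<open>Overlapping sub-boxes\<close>

text \<open>Boxes of the smaller side at spacing half that side fit
  \<open>2 * 2 ^ (n + 8) - 1\<close> times along each axis. The overlap keeps a short piece of a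
  walk inside one sub-box wherever it starts.\<close>

definition sub_centers :: "nat \<Rightarrow> nat \<Rightarrow> plane \<Rightarrow> plane set" where
  "sub_centers i n z =
     (\<lambda>(a, b). z - vec (side i (Suc n) / 2) + vec (side i n / 2)
        + (side i n / 2) *\<^sub>R vector [real a, real b])
     ` ({..<2 ^ (n + 9) - 1} \<times> {..<2 ^ (n + 9) - 1})"

text \<open>The covering in one coordinate. The middle halves of intervals of length
  \<open>m\<close> at spacing \<open>m / 2\<close> tile; near both ends the first or the last
  interval serves, because only points \<open>s\<close> of the large interval count.\<close>

lemma interval_cover:
  fixes t m :: real
  assumes "m > 0" "0 \<le> t" "t < real K * m" "K \<ge> 1"
  shows "\<exists>j<2 * K - 1. \<forall>s. 0 \<le> s \<and> s < real K * m \<and> \<bar>s - t\<bar> \<le> m / 4 \<longrightarrow>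
    real j * (m / 2) \<le> s \<and> s < real j * (m / 2) + m"
proof -
  consider "t < 3 * m / 4" | "t \<ge> real K * m - 3 * m / 4" | "3 * m / 4 \<le> t" "t < real K * m - 3 * m / 4"
    by linarith
  then show ?thesis
  proof cases
    case 1
    then show ?thesis using assms by (intro exI[of _ 0]) (auto simp: abs_if split: if_splits)
  next
    case 2
    then show ?thesis using assms
      by (intro exI[of _ "2 * K - 2"]) (auto simp: of_nat_diff algebra_simps abs_if split: if_splits)
  next
    case 3
    \<comment> \<open>The index of the interval whose middle half contains \<open>t\<close>.\<close>
    define j where "j = nat \<lfloor>t / (m / 2) - 1 / 2\<rfloor>"
    have "t / (m / 2) - 1 / 2 \<ge> 0" using 3 assms by (simp add: field_simps)
    then have j: "real j \<le> t / (m / 2) - 1 / 2" "t / (m / 2) - 1 / 2 < real j + 1"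
      unfolding j_def by linarith+
    then have j': "real j * (m / 2) \<le> t - m / 4" "t < real j * (m / 2) + 3 * m / 4"
      using assms by (simp_all add: field_simps)
    have "real j < 2 * real K - 2"
    proof -
      have "real j * (m / 2) < (2 * real K - 2) * (m / 2)" using 3 j' by (simp add: algebra_simps)
      then show ?thesis using assms by simp
    qed
    then have "j < 2 * K - 1" using assms(4) by linarith
    moreover have "real j * (m / 2) \<le> s \<and> s < real j * (m / 2) + m" if "\<bar>s - t\<bar> \<le> m / 4" for s
    proof -
      have "s - t \<le> m / 4" "t - s \<le> m / 4" using that by linarith+
      then show ?thesis using j' by linarith
    qed
    ultimately show ?thesis by blast
  qed
qed

lemma finite_sub_centers: "finite (sub_centers i n z)"
  by (simp add: sub_centers_def)

lemma card_sub_centers: "card (sub_centers i n z) \<le> 4 ^ (n + 9)"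
proof -
  let ?N = "2 ^ (n + 9) - 1 :: nat"
  have "card (sub_centers i n z) \<le> card ({..<?N} \<times> {..<?N})"
    unfolding sub_centers_def by (rule card_image_le) simp
  also have "\<dots> = ?N * ?N" by simp
  also have "\<dots> \<le> 2 ^ (n + 9) * 2 ^ (n + 9)" by (intro mult_mono) auto
  also have "\<dots> = 4 ^ (n + 9)" by (simp add: power_mult_distrib[symmetric])
  finally show ?thesis .
qed

lemma sub_centers_add: "sub_centers i n (z + t) = (\<lambda>c. c + t) ` sub_centers i n z"
  unfolding sub_centers_def image_image by (intro image_cong) (auto simp: algebra_simps)

lemma mem_Q_iff: "x \<in> Q m z \<longleftrightarrow>
    (z $ 1 - m / 2 \<le> x $ 1 \<and> x $ 1 < z $ 1 + m / 2) \<and> (z $ 2 - m / 2 \<le> x $ 2 \<and> x $ 2 < z $ 2 + m / 2)"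
  by (simp add: Q_def forall_2)

lemma norm_le_of_mem_Q:
  assumes "x \<in> Q m z"
  shows "norm (x - z) \<le> m"
proof -
  have "norm (x - z) \<le> \<bar>(x - z) $ 1\<bar> + \<bar>(x - z) $ 2\<bar>"
    using norm_le_l1_cart[of "x - z"] by (simp add: sum_2)
  moreover have "\<bar>(x - z) $ 1\<bar> \<le> m / 2" "\<bar>(x - z) $ 2\<bar> \<le> m / 2"
    using assms by (auto simp: mem_Q_iff abs_if)
  ultimately show ?thesis by simp
qed

lemma Q_sub_center_subset:
  assumes "c \<in> sub_centers i n z"
  shows "Q (side i n) c \<subseteq> Q (side i (Suc n)) z"
proof -
  define m where "m = side i n"
  have m: "m > 0" by (simp add: m_def side_pos)
  obtain a b :: nat where ab: "a < 2 ^ (n + 9) - 1" "b < 2 ^ (n + 9) - 1"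
    and c: "c = z - vec (side i (Suc n) / 2) + vec (m / 2) + (m / 2) *\<^sub>R vector [real a, real b]"
    using assms by (auto simp: sub_centers_def m_def)
  have "a + 2 \<le> 2 ^ (n + 9)" "b + 2 \<le> 2 ^ (n + 9)" using ab by auto
  then have "real (a + 2) \<le> real (2 ^ (n + 9))" "real (b + 2) \<le> real (2 ^ (n + 9))"
    by (simp_all only: of_nat_le_iff)
  then have "real a \<le> 2 * 2 ^ (n + 8) - 2" "real b \<le> 2 * 2 ^ (n + 8) - 2"
    by (auto simp: power_add)
  then have "m / 2 * real a \<le> m / 2 * (2 * 2 ^ (n + 8) - 2)" "m / 2 * real b \<le> m / 2 * (2 * 2 ^ (n + 8) - 2)"
    using m by (auto intro!: mult_left_mono)
  then have "m / 2 * real a \<le> side i (Suc n) - m" "m / 2 * real b \<le> side i (Suc n) - m"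
    by (simp_all add: side_Suc m_def algebra_simps)
  moreover have "m / 2 * real a \<ge> 0" "m / 2 * real b \<ge> 0" using m by auto
  moreover have "c $ 1 = z $ 1 - side i (Suc n) / 2 + m / 2 + m / 2 * real a"
    "c $ 2 = z $ 2 - side i (Suc n) / 2 + m / 2 + m / 2 * real b"
    by (simp_all add: c vector_2)
  ultimately show ?thesis
    unfolding m_def[symmetric] mem_Q_iff subset_iff by (smt (verit) field_sum_of_halves)
qed

lemma sub_centers_cover:
  assumes "x \<in> Q (side i (Suc n)) z"
  obtains c where "c \<in> sub_centers i n z"
    "\<And>w. w \<in> Q (side i (Suc n)) z \<Longrightarrow> norm (w - x) \<le> side i n / 4 \<Longrightarrow> w \<in> Q (side i n) c"
proof -
  define m M where "m = side i n" and "M = side i (Suc n)"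
  have m: "m > 0" by (simp add: m_def side_pos)
  have M: "M = real (2 ^ (n + 8)) * m" by (simp add: m_def M_def side_Suc)
  have K: "2 * 2 ^ (n + 8) - 1 = (2 ^ (n + 9) - 1 :: nat)" by (simp add: power_add)
  define off where "off w k = w $ k - z $ k + M / 2" for w k
  have rng: "0 \<le> off w k \<and> off w k < real (2 ^ (n + 8)) * m" if "w \<in> Q M z" for w k
    using that unfolding Q_def off_def M[symmetric] by (auto dest!: spec[of _ k])
  have x: "x \<in> Q M z" using assms by (simp add: M_def)
  have "\<exists>j<2 ^ (n + 9) - 1. \<forall>s. 0 \<le> s \<and> s < real (2 ^ (n + 8)) * m \<and> \<bar>s - off x k\<bar> \<le> m / 4 \<longrightarrow>
    real j * (m / 2) \<le> s \<and> s < real j * (m / 2) + m" for k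
    unfolding K[symmetric] using rng[OF x, of k] by (intro interval_cover m) auto
  then obtain j :: "2 \<Rightarrow> nat" where j: "\<And>k. j k < 2 ^ (n + 9) - 1"
    "\<And>k s. 0 \<le> s \<Longrightarrow> s < real (2 ^ (n + 8)) * m \<Longrightarrow> \<bar>s - off x k\<bar> \<le> m / 4 \<Longrightarrow>
      real (j k) * (m / 2) \<le> s \<and> s < real (j k) * (m / 2) + m"
    by metis
  define c :: plane where "c = z - vec (M / 2) + vec (m / 2) + (m / 2) *\<^sub>R vector [real (j 1), real (j 2)]"
  have "c \<in> sub_centers i n z"
    unfolding sub_centers_def c_def m_def M_def using j(1)
    by (intro image_eqI[where x = "(j 1, j 2)"]) auto
  moreover have "w \<in> Q m c" if w: "w \<in> Q M z" "norm (w - x) \<le> m / 4" for w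
  proof -
    have "\<bar>off w k - off x k\<bar> \<le> m / 4" for k
      using component_le_norm_cart[of "w - x" k] w(2) by (simp add: off_def)
    then have "real (j k) * (m / 2) \<le> off w k \<and> off w k < real (j k) * (m / 2) + m" for k
      using j(2) rng[OF w(1), of k] by blast
    from this[of 1] this[of 2] show ?thesis
      unfolding mem_Q_iff by (auto simp: c_def off_def vector_2 mult.commute)
  qed
  ultimately show ?thesis
    by (intro that) (auto simp: m_def M_def)
qed

section \<open>Bad boxes and walks in good boxes\<close>

text \<open>Beyond the distance \<open>2 * side i n\<close> mixing decouples two sub-boxes. Edges
  are measured against the smaller side, so that they are short for every sub-box at once; the walk
  estimates ask for at most an eighth of it.\<close>

primrec bad :: "'m measure \<Rightarrow> nat \<Rightarrow> nat \<Rightarrow> plane \<Rightarrow> 'm geo_graph set" where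
  "bad K i 0 z = {G \<in> space (graph_space K). long_edge (Q (side i 0) z) (side i 0 / 100) G}"
| "bad K i (Suc n) z =
     {G \<in> space (graph_space K). long_edge (Q (side i (Suc n)) z) (side i n / 100) G} \<union>
     (\<Union>(c, c')\<in>{(c, c') \<in> sub_centers i n z \<times> sub_centers i n z. norm (c' - c) > 2 * side i n}.
        bad K i n c \<inter> bad K i n c')"

text \<open>Guaranteed number of steps per unit of Euclidean displacement. It starts at
  \<open>1 / side i 0\<close> and never falls below half of that; the loss halves from scale to
  scale, like the inverse growth factors.\<close>

definition speed :: "nat \<Rightarrow> nat \<Rightarrow> real" where
  "speed i n = (1 / 2 + (1 / 2) ^ (n + 1)) / side i 0"

lemma speed_lower: "speed i n \<ge> 1 / (2 * side i 0)"
  using side_pos[of i 0] by (simp add: speed_def field_simps)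

text \<open>With \<open>q = (1 / 2) ^ n\<close>, the factor \<open>1 / 2 + q / 2\<close>, which is
  at most 1, may drop by \<open>q / 4\<close>, and the relative loss \<open>56 / 256 * q\<close> is
  smaller than that. The offset 8 in the growth factors is chosen for this.\<close>

lemma speed_Suc:
  assumes "side i (Suc n) / 8 \<le> d"
  shows "speed i (Suc n) * d \<le> speed i n * (d - 7 * side i n)"
proof -
  define q :: real where "q = (1 / 2) ^ n"
  have q: "0 < q" "q \<le> 1" by (auto simp: q_def power_le_one)
  have d: "7 * side i n \<le> 56 / 256 * q * d"
    using assms by (simp add: side_Suc q_def field_simps power_add)
  have "d > 0" using assms side_pos[of i "Suc n"] by linarith
  have "(1 / 2 + q / 4) * d \<le> (1 / 2 + q / 2) * (d - 56 / 256 * q * d)"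
  proof -
    have "(1 / 2 + q / 4) \<le> (1 / 2 + q / 2) * (1 - 56 / 256 * q)"
    proof -
      have "q * q \<le> q" using q by (simp add: mult_le_cancel_left1)
      moreover have "(1 / 2 + q / 2) * (1 - 56 / 256 * q) = 1 / 2 + q / 2 - 7 / 64 * q - 7 / 64 * (q * q)"
        by (simp add: field_simps)
      ultimately show ?thesis using q by linarith
    qed
    then have "(1 / 2 + q / 4) * d \<le> ((1 / 2 + q / 2) * (1 - 56 / 256 * q)) * d"
      using \<open>d > 0\<close> by (intro mult_right_mono) auto
    then show ?thesis by (simp add: algebra_simps)
  qed
  also have "\<dots> \<le> (1 / 2 + q / 2) * (d - 7 * side i n)"
    using d q by (intro mult_left_mono) auto
  finally show ?thesis
    using side_pos[of i 0] by (simp add: speed_def q_def divide_right_mono)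
qed

text \<open>Let \<open>m\<close> be the smaller side. Bad sub-boxes have their centres within
  \<open>2 * m\<close> of a common \<open>c\<^sub>0\<close> and their points within \<open>m\<close>
  of the centre, hence the exceptional radius \<open>3 * m\<close>. A piece that starts outside this
  ball and stays within \<open>m / 4\<close> of its start lies in one good sub-box, where the
  induction hypothesis applies.\<close>

lemma good_walk_length:
  assumes "G \<in> space (graph_space K)" "G \<notin> bad K i n z" "walk G (Q (side i n) z) k p"
    and "norm (p k - p 0) \<ge> side i n / 8"
  shows "real k \<ge> speed i n * norm (p k - p 0)"
  using assms(2-)
proof (induction n arbitrary: z k p)
  case 0
  have "norm (p k - p 0) \<le> real k * (side i 0 / 100)"
    by (rule walk_displacement_le[OF 0(2)]) (use 0(1) assms(1) in auto)
  also have "\<dots> \<le> real k * side i 0"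
    using side_pos[of i 0] by (intro mult_left_mono) auto
  finally show ?case using side_pos[of i 0] by (simp add: speed_def field_simps)
next
  case (Suc n)
  define m where "m = side i n"
  have m: "m > 0" by (simp add: m_def side_pos)
  let ?B = "Q (side i (Suc n)) z"
  have short: "\<not> long_edge ?B (m / 100) G"
    using Suc.prems(1) assms(1) by (auto simp: m_def)
  have "\<exists>c\<^sub>0. \<forall>c\<in>sub_centers i n z. G \<in> bad K i n c \<longrightarrow> norm (c - c\<^sub>0) \<le> 2 * m"
  proof (cases "\<exists>c\<^sub>0\<in>sub_centers i n z. G \<in> bad K i n c\<^sub>0")
    case True
    then obtain c\<^sub>0 where c\<^sub>0: "c\<^sub>0 \<in> sub_centers i n z" "G \<in> bad K i n c\<^sub>0" by blast
    have "norm (c - c\<^sub>0) \<le> 2 * m" if "c \<in> sub_centers i n z" "G \<in> bad K i n c" for c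
      using Suc.prems(1) c\<^sub>0 that by (force simp: m_def not_less)
    then show ?thesis by blast
  qed auto
  then obtain c\<^sub>0 where c\<^sub>0: "\<And>c. c \<in> sub_centers i n z \<Longrightarrow> G \<in> bad K i n c \<Longrightarrow> norm (c - c\<^sub>0) \<le> 2 * m"
    by blast
  have "real k \<ge> speed i n * (norm (p k - p 0) - 7 * m)"
  proof (rule walk_length_exceptional_ball[OF _ m _ short _ Suc.prems(2)])
    show "speed i n \<ge> 0" using speed_lower[of i n] side_pos[of i 0] by (smt (verit) divide_pos_pos)
    show "m / 100 \<le> m / 8" using m by simp
  next
    fix k p assume p: "walk G ?B k p" "\<And>l. l \<le> k \<Longrightarrow> norm (p l - p 0) \<le> m / 4"
      "p 0 \<notin> cball c\<^sub>0 (3 * m)" "norm (p k - p 0) \<ge> m / 8"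
    have pB: "p l \<in> ?B" if "l \<le> k" for l using p(1) that by (auto simp: walk_def)
    obtain c where c: "c \<in> sub_centers i n z" "\<And>w. w \<in> ?B \<Longrightarrow> norm (w - p 0) \<le> m / 4 \<Longrightarrow> w \<in> Q m c"
      using sub_centers_cover[OF pB[of 0]] unfolding m_def by auto
    have in_Q: "p l \<in> Q m c" if "l \<le> k" for l using c(2) pB p(2) that by blast
    have "G \<notin> bad K i n c"
    proof
      assume "G \<in> bad K i n c"
      then have "dist c\<^sub>0 c \<le> 2 * m" using c\<^sub>0[OF c(1)] by (simp add: dist_norm norm_minus_commute)
      moreover have "dist c (p 0) \<le> m"
        using norm_le_of_mem_Q[OF in_Q[of 0]] by (simp add: dist_norm norm_minus_commute)
      ultimately have "dist c\<^sub>0 (p 0) \<le> 3 * m" using dist_triangle[of c\<^sub>0 "p 0" c] by simp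
      then show False using p(3) by simp
    qed
    then show "real k \<ge> speed i n * norm (p k - p 0)"
      using Suc.IH[of c k p] walk_mono[OF p(1)] in_Q p(4) unfolding m_def by blast
  qed
  with speed_Suc[OF Suc.prems(3)] show ?case unfolding m_def by linarith
qed

section \<open>Measurability, translations and locality\<close>

lemma space_graph_space: "space (graph_space K) = {G. valid_graph K G}"
  unfolding graph_space_def by (rule space_measure_of) auto

lemma sets_graph_space: "sets (graph_space K) = sigma_sets {G. valid_graph K G}
     ({vertex_count A B -` S \<inter> {G. valid_graph K G} | A B S.
         A \<in> sets borel \<and> B \<in> sets K \<and> S \<in> sets borel} \<union>
      {edge_count A A' -` S \<inter> {G. valid_graph K G} | A A' S.
         A \<in> sets borel \<and> A' \<in> sets borel \<and> S \<in> sets borel})"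
  unfolding graph_space_def by (rule sets_measure_of) auto

lemma vertex_count_measurable:
  assumes "A \<in> sets borel" "B \<in> sets K"
  shows "vertex_count A B \<in> borel_measurable (graph_space K)"
  using assms by (intro measurableI) (auto simp: sets_graph_space space_graph_space intro!: sigma_sets.Basic)

lemma edge_count_measurable:
  assumes "A \<in> sets borel" "A' \<in> sets borel"
  shows "edge_count A A' \<in> borel_measurable (graph_space K)"
  using assms by (intro measurableI) (auto simp: sets_graph_space space_graph_space intro!: sigma_sets.Basic)

lemma adj_in_verts: "G \<in> space (graph_space K) \<Longrightarrow> adj G x y \<Longrightarrow> x \<in> verts G \<and> y \<in> verts G"
  unfolding space_graph_space valid_graph_def adj_def by (auto simp: doubleton_eq_iff)

lemma adj_translate: "adj (translate t G) x y \<longleftrightarrow> adj G (x - t) (y - t)"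
proof -
  have "{x, y} \<in> (\<lambda>e. (\<lambda>x. x + t) ` e) ` edges G \<longleftrightarrow> {x - t, y - t} \<in> edges G"
  proof
    assume "{x, y} \<in> (\<lambda>e. (\<lambda>x. x + t) ` e) ` edges G"
    then obtain e where e: "e \<in> edges G" "(\<lambda>x. x + t) ` e = {x, y}" by auto
    have "e = (\<lambda>x. x - t) ` (\<lambda>x. x + t) ` e" by (simp add: image_image)
    also have "\<dots> = {x - t, y - t}" using e(2) by simp
    finally show "{x - t, y - t} \<in> edges G" using e(1) by simp
  qed (auto intro!: image_eqI[where x = "{x - t, y - t}"])
  then show ?thesis by (simp add: adj_def translate_def)
qed

lemma ncard_image: "inj_on f A \<Longrightarrow> ncard (f ` A) = ncard A"
  by (cases "finite A") (auto simp: ncard_def emeasure_count_space card_image finite_image_iff)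

lemma vertex_count_translate:
  "vertex_count A B (translate t G) = vertex_count ((\<lambda>x. x + t) -` A) B G"
proof -
  have "{v \<in> verts (translate t G). v \<in> A \<and> mark (translate t G) v \<in> B} =
      (\<lambda>x. x + t) ` {v \<in> verts G. v \<in> (\<lambda>x. x + t) -` A \<and> mark G v \<in> B}"
    by (auto simp: translate_def)
  then show ?thesis
    unfolding vertex_count_def by (simp add: ncard_image inj_on_def)
qed

lemma edge_count_translate:
  "edge_count A A' (translate t G) = edge_count ((\<lambda>x. x + t) -` A) ((\<lambda>x. x + t) -` A') G"
proof -
  have "{(x, y). adj (translate t G) x y \<and> x \<in> A \<and> y \<in> A'} =
      (\<lambda>(x, y). (x + t, y + t)) `
        {(x, y). adj G x y \<and> x \<in> (\<lambda>x. x + t) -` A \<and> y \<in> (\<lambda>x. x + t) -` A'}"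
    by (auto simp: adj_translate intro!: image_eqI[where x = "(x - t, y - t)" for x y])
  then show ?thesis
    unfolding edge_count_def by (simp add: ncard_image inj_on_def)
qed

lemma valid_graph_translate: "valid_graph K G \<Longrightarrow> valid_graph K (translate t G)"
  unfolding valid_graph_def translate_def by fastforce

lemma translate_in_space: "G \<in> space (graph_space K) \<Longrightarrow> translate t G \<in> space (graph_space K)"
  by (simp add: space_graph_space valid_graph_translate)

lemma translate_measurable: "translate t \<in> measurable (graph_space K) (graph_space K)"
proof -
  have shift: "(\<lambda>x. x + t) -` A \<in> sets borel" if "A \<in> sets borel" for A :: "plane set"
    using measurable_sets[of "\<lambda>x. x + t" borel borel A] that by simp
  have "translate t -` y \<inter> space (graph_space K) \<in> sets (graph_space K)"
    if "y \<in> {vertex_count A B -` S \<inter> {G. valid_graph K G} | A B S.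
         A \<in> sets borel \<and> B \<in> sets K \<and> S \<in> sets borel} \<union>
      {edge_count A A' -` S \<inter> {G. valid_graph K G} | A A' S.
         A \<in> sets borel \<and> A' \<in> sets borel \<and> S \<in> sets borel}" for y
    using that
  proof (elim UnE CollectE exE conjE)
    fix A B S assume *: "y = vertex_count A B -` S \<inter> {G. valid_graph K G}"
      "A \<in> sets borel" "B \<in> sets K" "S \<in> sets borel"
    have "translate t -` y \<inter> space (graph_space K) =
        vertex_count ((\<lambda>x. x + t) -` A) B -` S \<inter> space (graph_space K)"
      using valid_graph_translate by (auto simp: * vertex_count_translate space_graph_space)
    then show ?thesis
      using measurable_sets[OF vertex_count_measurable[OF shift] *(4)] * by simp
  next
    fix A A' S assume *: "y = edge_count A A' -` S \<inter> {G. valid_graph K G}"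
      "A \<in> sets borel" "A' \<in> sets borel" "S \<in> sets borel"
    have "translate t -` y \<inter> space (graph_space K) =
        edge_count ((\<lambda>x. x + t) -` A) ((\<lambda>x. x + t) -` A') -` S \<inter> space (graph_space K)"
      using valid_graph_translate by (auto simp: * edge_count_translate space_graph_space)
    then show ?thesis
      using measurable_sets[OF edge_count_measurable[OF shift shift] *(4)] * by simp
  qed
  then show ?thesis
    by (subst (2) graph_space_def, intro measurable_measure_of)
      (auto simp: space_graph_space valid_graph_translate)
qed

lemma borel_Q: "Q m z \<in> sets borel"
proof -
  have "Q m z = {x. z $ 1 - m / 2 \<le> x $ 1 \<and> z $ 2 - m / 2 \<le> x $ 2} \<inter>
      {x. x $ 1 < z $ 1 + m / 2 \<and> x $ 2 < z $ 2 + m / 2}"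
    by (auto simp: mem_Q_iff)
  moreover have "closed {x :: plane. z $ 1 - m / 2 \<le> x $ 1 \<and> z $ 2 - m / 2 \<le> x $ 2}"
    by (intro closed_Collect_conj closed_Collect_le continuous_intros)
  moreover have "open {x :: plane. x $ 1 < z $ 1 + m / 2 \<and> x $ 2 < z $ 2 + m / 2}"
    by (intro open_Collect_conj open_Collect_less continuous_intros)
  ultimately show ?thesis by auto
qed

text \<open>The condition \<open>norm (x - y) > r\<close> is open, so it is a countable union of
  products of basic open sets. Whether an edge joins the two sides of such a product is seen by
  \<open>edge_count\<close>.\<close>

lemma long_edge_measurable:
  assumes S: "S \<in> sets borel"
  shows "{G \<in> space (graph_space K). long_edge S r G} \<in> sets (graph_space K)"
proof -
  obtain B :: "plane set set" where B: "countable B" "topological_basis B"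
    using ex_countable_basis by blast
  define R where "R = {(a, b) \<in> B \<times> B. \<forall>x\<in>a. \<forall>y\<in>b. norm (x - y) > r}"
  have "countable R"
    by (rule countable_subset[of _ "B \<times> B"]) (use B in \<open>auto simp: R_def\<close>)
  have cover: "\<exists>(a, b)\<in>R. x \<in> a \<and> y \<in> b" if "norm (x - y) > r" for x y
  proof -
    have "open {e :: plane \<times> plane. norm (fst e - snd e) > r}"
      by (intro open_Collect_less continuous_intros)
    moreover have "(x, y) \<in> {e. norm (fst e - snd e) > r}" using that by simp
    ultimately obtain a b where "open a" "open b" "(x, y) \<in> a \<times> b"
      "a \<times> b \<subseteq> {e. norm (fst e - snd e) > r}"
      by (rule open_prod_elim)
    moreover from this obtain a' b' where "a' \<in> B" "x \<in> a'" "a' \<subseteq> a" "b' \<in> B" "y \<in> b'" "b' \<subseteq> b"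
      using topological_basisE[OF B(2), of a x] topological_basisE[OF B(2), of b y] by (metis mem_Sigma_iff)
    moreover have "norm (u - v) > r" if "u \<in> a'" "v \<in> b'" for u v
    proof -
      have "(u, v) \<in> a \<times> b" using that \<open>a' \<subseteq> a\<close> \<open>b' \<subseteq> b\<close> by blast
      then show ?thesis using \<open>a \<times> b \<subseteq> _\<close> by auto
    qed
    ultimately have "(a', b') \<in> R" unfolding R_def by blast
    then show ?thesis using \<open>x \<in> a'\<close> \<open>y \<in> b'\<close> by blast
  qed
  have "long_edge S r G \<longleftrightarrow> (\<exists>e\<in>R. edge_count (fst e \<inter> S) (snd e \<inter> S) G \<noteq> 0)" for G :: "'b geo_graph"
  proof -
    have "edge_count a b G \<noteq> 0 \<longleftrightarrow> (\<exists>x\<in>a. \<exists>y\<in>b. adj G x y)" for a b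
      unfolding edge_count_def ncard_def by (subst emeasure_count_space_eq_0) auto
    then have "(\<exists>e\<in>R. edge_count (fst e \<inter> S) (snd e \<inter> S) G \<noteq> 0) \<longleftrightarrow>
        (\<exists>e\<in>R. \<exists>x\<in>fst e \<inter> S. \<exists>y\<in>snd e \<inter> S. adj G x y)"
      by simp
    also have "\<dots> \<longleftrightarrow> (\<exists>x\<in>S. \<exists>y\<in>S. adj G x y \<and> (\<exists>e\<in>R. x \<in> fst e \<and> y \<in> snd e))"
      by blast
    finally have rect: "(\<exists>e\<in>R. edge_count (fst e \<inter> S) (snd e \<inter> S) G \<noteq> 0) \<longleftrightarrow> \<dots>" .
    have "(\<exists>e\<in>R. x \<in> fst e \<and> y \<in> snd e) \<longleftrightarrow> norm (x - y) > r" for x y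
    proof
      assume "norm (x - y) > r"
      then show "\<exists>e\<in>R. x \<in> fst e \<and> y \<in> snd e" using cover[of x y] by (simp add: case_prod_beta)
    next
      assume "\<exists>e\<in>R. x \<in> fst e \<and> y \<in> snd e"
      then obtain a b where "(a, b) \<in> R" "x \<in> a" "y \<in> b" by (metis prod.collapse)
      then show "norm (x - y) > r" unfolding R_def by blast
    qed
    then show ?thesis unfolding rect by (simp add: long_edge_def)
  qed
  then have "{G \<in> space (graph_space K). long_edge S r G} =
      (\<Union>e\<in>R. {G \<in> space (graph_space K). edge_count (fst e \<inter> S) (snd e \<inter> S) G \<noteq> 0})"
    by auto
  also have "\<dots> \<in> sets (graph_space K)"
  proof (intro sets.countable_UN'[OF \<open>countable R\<close>] image_subsetI)
    fix e assume "e \<in> R"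
    then have "fst e \<inter> S \<in> sets borel" "snd e \<inter> S \<in> sets borel"
      using S topological_basis_open[OF B(2)] by (auto simp: R_def)
    note [measurable] = edge_count_measurable[OF this, of K]
    show "{G \<in> space (graph_space K). edge_count (fst e \<inter> S) (snd e \<inter> S) G \<noteq> 0} \<in> sets (graph_space K)"
      by measurable
  qed
  finally show ?thesis .
qed

lemma bad_subset_space: "bad K i n z \<subseteq> space (graph_space K)"
  by (induction n arbitrary: z) auto

lemma bad_Suc_iff: "G \<in> bad K i (Suc n) z \<longleftrightarrow>
    G \<in> space (graph_space K) \<and>
      (long_edge (Q (side i (Suc n)) z) (side i n / 100) G \<or>
       (\<exists>c\<in>sub_centers i n z. \<exists>c'\<in>sub_centers i n z.
          norm (c' - c) > 2 * side i n \<and> G \<in> bad K i n c \<and> G \<in> bad K i n c'))"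
  using bad_subset_space[of K i n] by auto

lemma bad_measurable: "bad K i n z \<in> sets (graph_space K)"
proof (induction n arbitrary: z)
  case (Suc n)
  have "finite {(c, c') \<in> sub_centers i n z \<times> sub_centers i n z. norm (c' - c) > 2 * side i n}"
    by (rule finite_subset[of _ "sub_centers i n z \<times> sub_centers i n z"]) (auto simp: finite_sub_centers)
  then show ?case
    using Suc by (auto intro!: sets.Un long_edge_measurable borel_Q sets.finite_UN)
qed (simp add: long_edge_measurable borel_Q)

lemma mem_Q_translate: "x \<in> Q m (z + t) \<longleftrightarrow> x - t \<in> Q m z"
  by (simp add: Q_def algebra_simps)

lemma long_edge_translate: "long_edge (Q m (z + t)) r (translate t G) \<longleftrightarrow> long_edge (Q m z) r G"
proof
  assume "long_edge (Q m (z + t)) r (translate t G)"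
  then obtain x y where "x - t \<in> Q m z" "y - t \<in> Q m z" "adj G (x - t) (y - t)" "norm (x - y) > r"
    by (auto simp: long_edge_def mem_Q_translate adj_translate)
  then show "long_edge (Q m z) r G"
    unfolding long_edge_def by (intro bexI[of _ "x - t"] bexI[of _ "y - t"]) auto
next
  assume "long_edge (Q m z) r G"
  then obtain x y where "x \<in> Q m z" "y \<in> Q m z" "adj G x y" "norm (x - y) > r"
    by (auto simp: long_edge_def)
  then show "long_edge (Q m (z + t)) r (translate t G)"
    unfolding long_edge_def by (intro bexI[of _ "x + t"] bexI[of _ "y + t"]) (auto simp: mem_Q_translate adj_translate)
qed

lemma bad_translate:
  assumes "G \<in> space (graph_space K)"
  shows "translate t G \<in> bad K i n (z + t) \<longleftrightarrow> G \<in> bad K i n z"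
proof (induction n arbitrary: z)
  case (Suc n)
  then show ?case
    using assms by (simp add: bad_Suc_iff long_edge_translate translate_in_space sub_centers_add del: bad.simps)
qed (use assms in \<open>simp add: long_edge_translate translate_in_space\<close>)

lemma long_edge_local:
  assumes "agree_on B G H"
  shows "long_edge B r G \<longleftrightarrow> long_edge B r H"
proof -
  have "adj G x y \<longleftrightarrow> adj H x y" if "x \<in> B" "y \<in> B" for x y
  proof -
    have "{x, y} \<in> {e \<in> edges G. e \<subseteq> B} \<longleftrightarrow> {x, y} \<in> {e \<in> edges H. e \<subseteq> B}"
      using assms unfolding agree_on_def by simp
    then show ?thesis using that by (simp add: adj_def)
  qed
  then show ?thesis by (auto simp: long_edge_def)
qed

lemma agree_on_subset:
  assumes "agree_on B G H" "A \<subseteq> B"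
  shows "agree_on A G H"
proof -
  have "{e \<in> edges G. e \<subseteq> A} = {e \<in> {e \<in> edges G. e \<subseteq> B}. e \<subseteq> A}" 
    "{e \<in> edges H. e \<subseteq> A} = {e \<in> {e \<in> edges H. e \<subseteq> B}. e \<subseteq> A}" using assms(2) by auto
  then have "{e \<in> edges G. e \<subseteq> A} = {e \<in> edges H. e \<subseteq> A}"
    using assms(1) unfolding agree_on_def by simp
  then show ?thesis using assms unfolding agree_on_def by blast
qed

lemma bad_local:
  assumes "G \<in> space (graph_space K)" "H \<in> space (graph_space K)" "agree_on (Q (side i n) z) G H"
  shows "G \<in> bad K i n z \<longleftrightarrow> H \<in> bad K i n z"
  using assms(3)
proof (induction n arbitrary: z)
  case 0
  then show ?case using assms(1,2) long_edge_local by auto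
next
  case (Suc n)
  have "G \<in> bad K i n c \<longleftrightarrow> H \<in> bad K i n c" if "c \<in> sub_centers i n z" for c
    using Suc.IH agree_on_subset[OF Suc.prems Q_sub_center_subset[OF that]] by blast
  moreover have "long_edge (Q (side i (Suc n)) z) r G \<longleftrightarrow> long_edge (Q (side i (Suc n)) z) r H" for r
    using long_edge_local[OF Suc.prems] .
  ultimately show ?case using assms(1,2) unfolding bad_Suc_iff by blast
qed

section \<open>All renormalization schemes as one box event\<close>

text \<open>A box event receives only the set of points, so side and centre must be recoverable from
  it. Boxes being half-open, the lower corner belongs to the box and the upper one does not.\<close>

lemma Q_eq_iff:
  assumes "m > 0" "m' > 0"
  shows "Q m z = Q m' z' \<longleftrightarrow> m = m' \<and> z = z'"
proof
  assume eq: "Q m z = Q m' z'"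
  have corner: "z $ i - m / 2 \<ge> z' $ i - m' / 2" if "Q m z = Q m' z'" "m > 0" for m m' z z' i
  proof -
    have "z - vec (m / 2) \<in> Q m z" using \<open>m > 0\<close> by (simp add: Q_def)
    then have "z - vec (m / 2) \<in> Q m' z'" using that(1) by blast
    then show ?thesis by (simp add: Q_def)
  qed
  have low: "z $ i - m / 2 = z' $ i - m' / 2" for i
    using corner[OF eq assms(1), of i] corner[OF eq[symmetric] assms(2), of i] by simp
  have size: "m' \<le> m" if "Q m z = Q m' z'" "m > 0" "\<And>i. z $ i - m / 2 = z' $ i - m' / 2" for m m' z z'
  proof (rule ccontr)
    assume "\<not> m' \<le> m"
    have "z + vec (m / 2) \<in> Q m' z'"
      unfolding Q_def
    proof safe
      fix i :: 2
      show "z' $ i - m' / 2 \<le> (z + vec (m / 2)) $ i" "(z + vec (m / 2)) $ i < z' $ i + m' / 2"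
        using that(3)[of i] that(2) \<open>\<not> m' \<le> m\<close> by auto
    qed
    moreover have "z + vec (m / 2) \<notin> Q m z" by (simp add: Q_def)
    ultimately show False using that(1) by blast
  qed
  have "m = m'"
    using size[OF eq assms(1) low] size[OF eq[symmetric] assms(2) low[symmetric]] by simp
  then show "m = m' \<and> z = z'" using low by (simp add: vec_eq_iff)
qed auto

text \<open>Mixing is assumed for one event at all box sizes, whereas the recursion depth of
  \<open>bad\<close> varies with the scale. The depth is therefore read off the side of the
  box.\<close>

definition renorm_event :: "'m measure \<Rightarrow> plane set \<Rightarrow> 'm geo_graph set" where
  "renorm_event K S = {G. \<exists>i n z. S = Q (side i n) z \<and> G \<in> bad K i n z}"

lemma renorm_event_side: "renorm_event K (Q (side i n) z) = bad K i n z"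
  by (auto simp: renorm_event_def Q_eq_iff side_pos side_eq_iff)

lemma renorm_event_other: "m > 0 \<Longrightarrow> \<nexists>i n. m = side i n \<Longrightarrow> renorm_event K (Q m z) = {}"
  by (auto simp: renorm_event_def Q_eq_iff side_pos)

lemma local_box_event_renorm_event: "local_box_event K (renorm_event K)"
proof -
  have "renorm_event K (Q m z) \<in> sets (graph_space K)"
    "G \<in> space (graph_space K) \<Longrightarrow>
      translate t G \<in> renorm_event K (Q m (z + t)) \<longleftrightarrow> G \<in> renorm_event K (Q m z)"
    "G \<in> space (graph_space K) \<Longrightarrow> H \<in> space (graph_space K) \<Longrightarrow> agree_on (Q m z) G H \<Longrightarrow>
      G \<in> renorm_event K (Q m z) \<longleftrightarrow> H \<in> renorm_event K (Q m z)"
    if "m > 0" for m z t G H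
  proof (atomize (full), cases "\<exists>i n. m = side i n")
    case True
    then obtain i n where "m = side i n" by blast
    then show "renorm_event K (Q m z) \<in> sets (graph_space K) \<and>
      (G \<in> space (graph_space K) \<longrightarrow>
        (translate t G \<in> renorm_event K (Q m (z + t)) \<longleftrightarrow> G \<in> renorm_event K (Q m z))) \<and>
      (G \<in> space (graph_space K) \<longrightarrow> H \<in> space (graph_space K) \<longrightarrow> agree_on (Q m z) G H \<longrightarrow>
        (G \<in> renorm_event K (Q m z) \<longleftrightarrow> H \<in> renorm_event K (Q m z)))"
      using bad_local by (simp add: renorm_event_side bad_measurable bad_translate) blast
  next
    case False
    then show "renorm_event K (Q m z) \<in> sets (graph_space K) \<and>
      (G \<in> space (graph_space K) \<longrightarrow>
        (translate t G \<in> renorm_event K (Q m (z + t)) \<longleftrightarrow> G \<in> renorm_event K (Q m z))) \<and>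
      (G \<in> space (graph_space K) \<longrightarrow> H \<in> space (graph_space K) \<longrightarrow> agree_on (Q m z) G H \<longrightarrow>
        (G \<in> renorm_event K (Q m z) \<longleftrightarrow> H \<in> renorm_event K (Q m z)))"
      using renorm_event_other[OF \<open>m > 0\<close> False, where K = K] by simp
  qed
  then show ?thesis unfolding local_box_event_def box_event_def by blast
qed

section \<open>Probability estimates\<close>

lemma (in prob_space) covariance_indicator:
  assumes [measurable]: "A \<in> events" "B \<in> events"
  shows "covariance M (indicator A) (indicator B) = prob (A \<inter> B) - prob A * prob B"
proof -
  have [simp]: "integrable M (indicator A :: 'a \<Rightarrow> real)" "integrable M (indicator B :: 'a \<Rightarrow> real)"
    "integrable M (indicator (A \<inter> B) :: 'a \<Rightarrow> real)"
    by (auto intro!: integrable_real_indicator simp: less_top[symmetric])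
  have "covariance M (indicator A) (indicator B) =
      (\<integral>w. indicator (A \<inter> B) w - prob B * indicator A w - prob A * indicator B w + prob A * prob B \<partial>M)"
    unfolding covariance_def
    by (intro Bochner_Integration.integral_cong) (auto simp: algebra_simps indicator_inter_arith)
  also have "\<dots> = prob (A \<inter> B) - prob B * prob A - prob A * prob B + prob A * prob B"
    by (simp add: prob_space)
  finally show ?thesis by simp
qed

locale stationary_graph = prob_space P for P :: "'m geo_graph measure" +
  fixes K :: "'m measure"
  assumes sets_P: "sets P = sets (graph_space K)"
    and stationary: "stationary P"
begin

lemma space_P: "space P = space (graph_space K)"
  by (rule sets_eq_imp_space_eq[OF sets_P])

lemma translate_measurable_P: "translate t \<in> measurable P P"
  using translate_measurable[of t K] by (simp add: measurable_cong_sets[OF sets_P sets_P])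

lemma prob_translate:
  assumes "A \<in> events"
  shows "prob (translate t -` A \<inter> space P) = prob A"
  using measure_distr[OF translate_measurable_P assms, of t] stationary
  by (simp add: stationary_def)

lemma nn_integral_translate:
  assumes "f \<in> borel_measurable P"
  shows "(\<integral>\<^sup>+G. f (translate t G) \<partial>P) = (\<integral>\<^sup>+G. f G \<partial>P)"
  using nn_integral_distr[OF translate_measurable_P, of f t] assms stationary
  by (simp add: stationary_def)

lemma bad_events: "bad K i n z \<in> events"
  by (simp add: sets_P bad_measurable)

lemma prob_bad: "prob (bad K i n z) = prob (bad K i n 0)"
proof -
  have "translate z -` bad K i n z \<inter> space P = bad K i n 0"
    using bad_translate[where z = 0 and t = z and K = K] bad_subset_space[of K i n 0] by (auto simp: space_P)
  with prob_translate[OF bad_events[of i n z], of z] show ?thesis by simp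
qed

lemma prob_bad_pair: "prob (bad K i n c \<inter> bad K i n c') = prob (bad K i n 0 \<inter> bad K i n (c' - c))"
proof -
  have "translate c -` (bad K i n c \<inter> bad K i n c') \<inter> space P = bad K i n 0 \<inter> bad K i n (c' - c)"
    using bad_translate[where z = 0 and t = c and K = K] bad_translate[where z = "c' - c" and t = c and K = K]
      bad_subset_space[of K i n 0] by (auto simp: space_P)
  with prob_translate[of "bad K i n c \<inter> bad K i n c'" c] show ?thesis
    by (simp add: bad_events sets.Int)
qed

text \<open>The order of the quantifiers matters: \<open>prob_bad_decay\<close> chooses
  \<open>i\<close> only after \<open>C\<close> and \<open>m\<^sub>0\<close>.\<close>

lemma bad_mixing:
  assumes "polynomial_mixing K P \<xi>"
  shows "\<exists>C m\<^sub>0. C \<ge> 0 \<and> (\<forall>i n z. side i n \<ge> m\<^sub>0 \<longrightarrow> norm z > 2 * side i n \<longrightarrow>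
    prob (bad K i n 0 \<inter> bad K i n z) \<le> (prob (bad K i n 0))\<^sup>2 + C * side i n powr \<xi>)"
proof -
  obtain C m\<^sub>0 where C: "\<And>m z. m \<ge> m\<^sub>0 \<Longrightarrow> norm z > 2 \<Longrightarrow>
      covariance P (indicator (renorm_event K (Q m 0))) (indicator (renorm_event K (Q m (m *\<^sub>R z)))) \<le> C * m powr \<xi>"
    using assms local_box_event_renorm_event[of K]
    unfolding polynomial_mixing_def eventually_at_top_linorder by metis
  have "prob (bad K i n 0 \<inter> bad K i n z) \<le> (prob (bad K i n 0))\<^sup>2 + max C 0 * side i n powr \<xi>"
    if "side i n \<ge> m\<^sub>0" "norm z > 2 * side i n" for i n z
  proof -
    let ?m = "side i n"
    have "norm (z /\<^sub>R ?m) > 2" using that(2) side_pos[of i n] by (simp add: field_simps)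
    from C[OF that(1) this] have "prob (bad K i n 0 \<inter> bad K i n z) - prob (bad K i n 0) * prob (bad K i n z) \<le> C * ?m powr \<xi>"
      using side_pos[of i n] by (simp add: renorm_event_side covariance_indicator bad_events)
    also have "\<dots> \<le> max C 0 * ?m powr \<xi>" by (intro mult_right_mono) auto
    finally show ?thesis by (simp add: prob_bad[of i n z] power2_eq_square)
  qed
  then show ?thesis by (intro exI[of _ "max C 0"] exI[of _ m\<^sub>0]) auto
qed

lemma prob_long_edge:
  assumes "polynomial_long_edges P \<mu>"
  shows "\<exists>C n\<^sub>0. C \<ge> 0 \<and> n\<^sub>0 > 0 \<and> (\<forall>m\<ge>1. \<forall>n\<ge>n\<^sub>0.
    prob {G \<in> space P. long_edge (Q m 0) n G} \<le> C * m\<^sup>2 * n powr \<mu>)"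
proof -
  have eq: "long_edge_event P m n = {G \<in> space P. long_edge (Q m 0) n G}" for m n
    using adj_in_verts unfolding long_edge_event_def long_edge_def space_P by blast
  obtain C n\<^sub>0 where C: "n\<^sub>0 > 0" "\<And>m n. m \<ge> 1 \<Longrightarrow> n \<ge> n\<^sub>0 \<Longrightarrow>
      prob {G \<in> space P. long_edge (Q m 0) n G} \<le> C * m\<^sup>2 * n powr \<mu>"
    using assms unfolding polynomial_long_edges_def eq by blast
  have "C * m\<^sup>2 * n powr \<mu> \<le> max C 0 * m\<^sup>2 * n powr \<mu>" for m n
    by (intro mult_right_mono) auto
  then show ?thesis using C by (intro exI[of _ "max C 0"] exI[of _ n\<^sub>0]) (auto intro!: order_trans[OF C(2)])
qed

text \<open>Union bound over the ordered pairs of distant sub-boxes. By stationarity only the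
  difference of their centres matters.\<close>

lemma prob_bad_Suc_le:
  assumes "\<And>z. norm z > 2 * side i n \<Longrightarrow> prob (bad K i n 0 \<inter> bad K i n z) \<le> q" "q \<ge> 0"
  shows "prob (bad K i (Suc n) 0) \<le>
    prob {G \<in> space P. long_edge (Q (side i (Suc n)) 0) (side i n / 100) G} + 16 ^ (n + 9) * q"
proof -
  let ?S = "sub_centers i n 0"
  define R where "R = {(c, c') \<in> ?S \<times> ?S. norm (c' - c) > 2 * side i n}"
  have R: "R \<subseteq> ?S \<times> ?S" "finite R"
    using finite_sub_centers[of i n 0] by (auto simp: R_def intro: finite_subset[of _ "?S \<times> ?S"])
  let ?B = "\<lambda>e. bad K i n (fst e) \<inter> bad K i n (snd e)"
  have "bad K i (Suc n) 0 =
      {G \<in> space P. long_edge (Q (side i (Suc n)) 0) (side i n / 100) G} \<union> (\<Union>e\<in>R. ?B e)"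
    by (auto simp: R_def space_P)
  also have "prob \<dots> \<le> prob {G \<in> space P. long_edge (Q (side i (Suc n)) 0) (side i n / 100) G} + prob (\<Union>e\<in>R. ?B e)"
  proof (rule measure_Un_le)
    show "(\<Union>e\<in>R. ?B e) \<in> events"
      using R(2) by (intro sets.finite_UN sets.Int bad_events)
  qed (simp add: sets_P space_P long_edge_measurable borel_Q)
  also have "prob (\<Union>e\<in>R. ?B e) \<le> (\<Sum>e\<in>R. prob (?B e))"
    using R by (intro finite_measure_subadditive_finite) (auto simp: bad_events)
  also have "\<dots> \<le> (\<Sum>e\<in>R. q)"
  proof (rule sum_mono)
    fix e assume "e \<in> R"
    then show "prob (?B e) \<le> q"
      unfolding prob_bad_pair[of i n "fst e"] by (intro assms(1)) (auto simp: R_def)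
  qed
  also have "\<dots> = real (card R) * q" by simp
  also have "\<dots> \<le> 16 ^ (n + 9) * q"
  proof (intro mult_right_mono assms(2))
    have "card R \<le> card (?S \<times> ?S)" using R finite_sub_centers[of i n 0] by (intro card_mono) auto
    also have "\<dots> = card ?S * card ?S" by (rule card_cartesian_product)
    also have "\<dots> \<le> 4 ^ (n + 9) * 4 ^ (n + 9)" by (intro mult_mono card_sub_centers) auto
    also have "\<dots> = 16 ^ (n + 9)" by (simp add: power_mult_distrib[symmetric])
    finally show "real (card R) \<le> 16 ^ (n + 9)"
      by (metis of_nat_le_iff of_nat_numeral of_nat_power)
  qed
  finally show ?thesis by simp
qed

end

section \<open>Decay of the probability of a bad box\<close>

lemma side_exp_lower: "real (side_exp n) \<ge> (real n)\<^sup>2 / 2"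
proof (induction n)
  case (Suc n)
  then show ?case by (simp add: power2_eq_square field_simps)
qed simp

text \<open>The factor \<open>2 ^ (5 * (n + 8))\<close> collects the number of pairs of boxes in a renormalization
  step; it is subpolynomial in the scale \<open>side i n\<close>, which grows like \<open>2 powr (n\<^sup>2 / 2)\<close>.\<close>

lemma side_powr_dominates:
  assumes "\<delta> > 0" "A \<ge> 0" and i: "3 ^ i \<ge> (A * 2 powr (40 + 25 / (2 * \<delta>))) powr (1 / \<delta>)"
  shows "A * 2 ^ (5 * (n + 8)) \<le> side i n powr \<delta>"
proof -
  have "5 * real n \<le> 25 / (2 * \<delta>) + \<delta> * ((real n)\<^sup>2 / 2)"
  proof -
    \<comment> \<open>Completing the square absorbs the linear exponent \<open>5 * n\<close> into
      \<delta> times the quadratic lower bound for \<open>side_exp\<close>. The price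
      \<open>25 / (2 * \<delta>)\<close> and \<open>40 = 5 * 8\<close> are paid by
      \<open>3 ^ i\<close>.\<close>
    have "0 \<le> (\<delta> * real n - 5)\<^sup>2" by simp
    then show ?thesis using assms(1) by (simp add: power2_eq_square field_simps)
  qed
  also have "\<dots> \<le> 25 / (2 * \<delta>) + \<delta> * real (side_exp n)"
    using side_exp_lower[of n] assms(1) by simp
  finally have exp: "real (5 * (n + 8)) \<le> (40 + 25 / (2 * \<delta>)) + \<delta> * real (side_exp n)" by simp
  have "A * 2 ^ (5 * (n + 8)) = A * 2 powr real (5 * (n + 8))"
    by (subst powr_realpow) auto
  also have "\<dots> \<le> A * 2 powr ((40 + 25 / (2 * \<delta>)) + \<delta> * real (side_exp n))"
    using exp assms(2) by (intro mult_left_mono powr_mono) auto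
  also have "\<dots> = (A * 2 powr (40 + 25 / (2 * \<delta>))) * 2 powr (\<delta> * real (side_exp n))"
    by (simp add: powr_add)
  also have "\<dots> = ((A * 2 powr (40 + 25 / (2 * \<delta>))) powr (1 / \<delta>)) powr \<delta> * 2 powr (\<delta> * real (side_exp n))"
    using assms by (simp add: powr_powr)
  also have "\<dots> \<le> (3 ^ i) powr \<delta> * 2 powr (\<delta> * real (side_exp n))"
    using i assms by (intro mult_right_mono powr_mono2) auto
  also have "\<dots> = side i n powr \<delta>"
    by (simp add: side_def powr_mult powr_realpow[symmetric] powr_powr mult.commute)
  finally show ?thesis .
qed

text \<open>With \<open>k\<close> the ratio of consecutive scales, the pair terms contribute \<open>16 * k ^ 4\<close> times the
  mixing bound.\<close>

lemma renormalization_step: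
  fixes m k \<delta> \<xi> \<mu> C D p :: real
  assumes m: "m \<ge> 1" "k \<ge> 1" and \<delta>: "0 < \<delta>" "\<delta> \<le> 1" "2 * \<delta> \<le> - \<xi>" "2 * \<delta> \<le> - 2 - \<mu>"
    and CD: "C \<ge> 0" "D \<ge> 0" and p: "0 \<le> p" "p \<le> m powr - \<delta>"
    and big: "(C * (1 / 100) powr \<mu> + 16 + 16 * D) * k ^ 5 \<le> m powr \<delta>"
  shows "C * (k * m)\<^sup>2 * (m / 100) powr \<mu> + 16 * k ^ 4 * (p\<^sup>2 + D * m powr \<xi>) \<le> (k * m) powr - \<delta>"
proof -
  define A where "A = C * (1 / 100) powr \<mu> + 16 + 16 * D"
  \<comment> \<open>Common bound for \<open>p\<^sup>2\<close>, the mixing error and the long-edge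
    term.\<close>
  define X where "X = m powr - (2 * \<delta>)"
  have mp: "m > 0" using m by simp
  have X: "X > 0" using mp by (simp add: X_def)
  have "m\<^sup>2 * m powr \<mu> = m powr (2 + \<mu>)"
    using mp by (simp add: powr_add powr_numeral)
  also have "\<dots> \<le> X" unfolding X_def using m \<delta> by (intro powr_mono) auto
  finally have "C * k\<^sup>2 * (1 / 100) powr \<mu> * (m\<^sup>2 * m powr \<mu>) \<le> C * k ^ 4 * (1 / 100) powr \<mu> * X"
    using CD m by (intro mult_mono mult_left_mono mult_right_mono power_increasing) auto
  moreover have "(m / 100) powr \<mu> = m powr \<mu> * (1 / 100) powr \<mu>"
    using powr_mult[of m "1 / 100" \<mu>] by simp
  then have "C * (k * m)\<^sup>2 * (m / 100) powr \<mu> = C * k\<^sup>2 * (1 / 100) powr \<mu> * (m\<^sup>2 * m powr \<mu>)"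
    by (simp only: power_mult_distrib mult_ac)
  ultimately have 1: "C * (k * m)\<^sup>2 * (m / 100) powr \<mu> \<le> C * k ^ 4 * (1 / 100) powr \<mu> * X"
    by (simp only:)
  have "p\<^sup>2 \<le> (m powr - \<delta>)\<^sup>2" using p by (intro power_mono) auto
  also have "\<dots> = X" using mp by (simp add: X_def power2_eq_square powr_add[symmetric])
  finally have "p\<^sup>2 \<le> X" .
  moreover have "m powr \<xi> \<le> X" unfolding X_def using m \<delta> by (intro powr_mono) auto
  ultimately have "16 * k ^ 4 * (p\<^sup>2 + D * m powr \<xi>) \<le> 16 * k ^ 4 * (X + D * X)"
    using CD m by (intro mult_left_mono add_mono) auto
  with 1 have "C * (k * m)\<^sup>2 * (m / 100) powr \<mu> + 16 * k ^ 4 * (p\<^sup>2 + D * m powr \<xi>) \<le> A * (k ^ 4 * X)"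
    by (simp add: A_def algebra_simps)
  \<comment> \<open>Four of the five powers of \<open>k\<close> come from the pairs. The fifth pays
    for the passage from \<open>m\<close> to \<open>k * m\<close>, since \<delta> \<le> 1.\<close>
  also have "\<dots> \<le> m powr - \<delta> / k"
  proof -
    have "A * k ^ 5 * m powr - (2 * \<delta>) \<le> m powr \<delta> * m powr - (2 * \<delta>)"
      using big by (intro mult_right_mono) (auto simp: A_def)
    also have "\<dots> = m powr - \<delta>" by (simp add: powr_add[symmetric])
    finally show ?thesis
      using m by (simp add: X_def field_simps power_numeral_reduce)
  qed
  also have "\<dots> \<le> m powr - \<delta> * k powr - \<delta>"
  proof -
    have "k powr - 1 \<le> k powr - \<delta>" using m \<delta> by (intro powr_mono) auto
    then have "m powr - \<delta> * k powr - 1 \<le> m powr - \<delta> * k powr - \<delta>" by (intro mult_left_mono) auto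
    then show ?thesis using m by (simp add: powr_minus_divide)
  qed
  also have "\<dots> = (k * m) powr - \<delta>" using m by (simp add: powr_mult mult.commute)
  finally show ?thesis .
qed

context stationary_graph begin

text \<open>Induction on the scale. The squared induction hypothesis and both error terms decay with
  exponent at least twice \<delta>; half of this absorbs the number of pairs. At scale 0 only long
  edges make a box bad.\<close>

lemma prob_bad_decay:
  assumes "polynomial_mixing K P \<xi>" "\<xi> < 0" "polynomial_long_edges P \<mu>" "\<mu> < -2"
  shows "\<exists>\<delta>>0. \<exists>i. \<forall>n. prob (bad K i n 0) \<le> side i n powr - \<delta>"
proof -
  obtain D m\<^sub>0 where D: "D \<ge> 0" "\<And>i n z. side i n \<ge> m\<^sub>0 \<Longrightarrow> norm z > 2 * side i n \<Longrightarrow>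
      prob (bad K i n 0 \<inter> bad K i n z) \<le> (prob (bad K i n 0))\<^sup>2 + D * side i n powr \<xi>"
    using bad_mixing[OF assms(1)] by blast
  obtain C n\<^sub>0 where C: "C \<ge> 0" "\<And>m n. m \<ge> 1 \<Longrightarrow> n \<ge> n\<^sub>0 \<Longrightarrow>
      prob {G \<in> space P. long_edge (Q m 0) n G} \<le> C * m\<^sup>2 * n powr \<mu>"
    using prob_long_edge[OF assms(3)] by blast
  define \<delta> where "\<delta> = Min {1, - \<xi> / 2, (- 2 - \<mu>) / 2}"
  have \<delta>: "0 < \<delta>" "\<delta> \<le> 1" "2 * \<delta> \<le> - \<xi>" "2 * \<delta> \<le> - 2 - \<mu>"
    using assms(2,4) by (auto simp: \<delta>_def min_def)
  define A where "A = C * (1 / 100) powr \<mu> + 16 + 16 * D"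
  have A: "A \<ge> 0" "C * (1 / 100) powr \<mu> \<le> A" using C D by (auto simp: A_def)
  \<comment> \<open>The base side must exceed the mixing threshold, its hundredth must exceed
    \<open>n\<^sub>0\<close>, and the third bound is the hypothesis of
    \<open>side_powr_dominates\<close>.\<close>
  obtain i :: nat where "Max {m\<^sub>0, 100 * n\<^sub>0, (A * 2 powr (40 + 25 / (2 * \<delta>))) powr (1 / \<delta>)} < 3 ^ i"
    using real_arch_pow[of 3 "Max {m\<^sub>0, 100 * n\<^sub>0, (A * 2 powr (40 + 25 / (2 * \<delta>))) powr (1 / \<delta>)}"] by auto
  then have i: "m\<^sub>0 \<le> 3 ^ i" "100 * n\<^sub>0 \<le> 3 ^ i" "(A * 2 powr (40 + 25 / (2 * \<delta>))) powr (1 / \<delta>) \<le> 3 ^ i"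
    by auto
  have side_ge: "3 ^ i \<le> side i n" for n
    unfolding side_def by simp
  have big: "A * (2 ^ (n + 8)) ^ 5 \<le> side i n powr \<delta>" for n
    using side_powr_dominates[OF \<delta>(1) A(1) i(3), of n] by (simp add: power_mult[symmetric] mult.commute)
  have "prob (bad K i n 0) \<le> side i n powr - \<delta>" for n
  proof (induction n)
    case 0
    let ?m = "side i 0"
    have "prob (bad K i 0 0) \<le> C * ?m\<^sup>2 * (?m / 100) powr \<mu>"
      using C(2)[of ?m "?m / 100"] side_ge_1[of i 0] i(2) side_ge[of 0] by (simp add: space_P)
    also have "\<dots> = C * (1 / 100) powr \<mu> * ?m powr (2 + \<mu>)"
      using side_pos[of i 0] powr_mult[of ?m "1 / 100" \<mu>] by (simp add: powr_add powr_numeral)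
    also have "\<dots> \<le> A * ?m powr (- (2 * \<delta>))"
      using A \<delta> C side_ge_1[of i 0] by (intro mult_mono powr_mono) auto
    also have "\<dots> \<le> ?m powr \<delta> * ?m powr (- (2 * \<delta>))"
    proof (intro mult_right_mono)
      have "A * 1 \<le> A * (2 ^ (0 + 8)) ^ 5" using A by (intro mult_left_mono) auto
      then show "A \<le> ?m powr \<delta>" using big[of 0] by simp
    qed auto
    also have "\<dots> = ?m powr - \<delta>" by (simp add: powr_add[symmetric])
    finally show ?case .
  next
    case (Suc n)
    let ?m = "side i n" and ?k = "2 ^ (n + 8) :: real"
    let ?p = "prob (bad K i n 0)"
    have "prob (bad K i (Suc n) 0) \<le>
        prob {G \<in> space P. long_edge (Q (side i (Suc n)) 0) (?m / 100) G} +
        16 ^ (n + 9) * (?p\<^sup>2 + D * ?m powr \<xi>)"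
      using D i(1) side_ge[of n] by (intro prob_bad_Suc_le D(2)) auto
    also have "\<dots> \<le> C * (?k * ?m)\<^sup>2 * (?m / 100) powr \<mu> + 16 * ?k ^ 4 * (?p\<^sup>2 + D * ?m powr \<xi>)"
    proof (intro add_mono)
      show "prob {G \<in> space P. long_edge (Q (side i (Suc n)) 0) (?m / 100) G} \<le> C * (?k * ?m)\<^sup>2 * (?m / 100) powr \<mu>"
        unfolding side_Suc[symmetric] using side_ge_1[of i "Suc n"] side_ge[of n] i(2) by (intro C(2)) auto
      have "16 * ?k ^ 4 = 16 * (2 ^ 4) ^ (n + 8)" by (simp only: power_mult[symmetric] mult.commute)
      then have "16 ^ (n + 9) = 16 * ?k ^ 4" by (simp add: power_add)
      then show "16 ^ (n + 9) * (?p\<^sup>2 + D * ?m powr \<xi>) \<le> 16 * ?k ^ 4 * (?p\<^sup>2 + D * ?m powr \<xi>)" by simp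
    qed
    also have "\<dots> \<le> (?k * ?m) powr - \<delta>"
      using side_ge_1[of i n] \<delta> C(1) D(1) Suc big[of n] by (intro renormalization_step) (auto simp: A_def)
    finally show ?case by (simp add: side_Suc)
  qed
  then show ?thesis using \<delta>(1) by blast
qed

end

section \<open>Almost sure behaviour at large scales\<close>

lemma summable_geometric_powr:
  fixes f :: "nat \<Rightarrow> real"
  assumes "s < 0" "\<And>n. 0 \<le> f n" "\<forall>\<^sub>F n in sequentially. f n \<le> c * (2 ^ n) powr s"
  shows "summable f"
proof (rule summable_comparison_test_ev)
  have eq: "(2 ^ n) powr s = (2 powr s) ^ n" for n :: nat
    by (simp add: powr_realpow[symmetric] powr_powr mult.commute)
  show "summable (\<lambda>n. c * (2 powr s) ^ n)"
  proof (intro summable_mult summable_geometric)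
    have "2 powr s < 2 powr 0" using assms(1) by (intro powr_less_mono) auto
    then show "norm (2 powr s) < 1" by simp
  qed
  show "\<forall>\<^sub>F n in sequentially. norm (f n) \<le> c * (2 powr s) ^ n"
    using assms(3) by eventually_elim (use assms(2) in \<open>simp add: eq\<close>)
qed

lemma side_ge_power: "2 ^ n \<le> side i n"
proof -
  have "n \<le> side_exp n" by (induction n) auto
  then have "(2 :: real) ^ n \<le> 2 ^ side_exp n" by (intro power_increasing) auto
  also have "\<dots> \<le> side i n"
    unfolding side_def using mult_right_mono[of 1 "3 ^ i" "2 ^ side_exp n :: real"] by simp
  finally show ?thesis .
qed

text \<open>Tonelli for counting measures. It replaces the degree sum by an edge count, which is
  measurable and whose behaviour under translations is known.\<close>

lemma nn_integral_deg:
  assumes "G \<in> space (graph_space K)"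
  shows "(\<integral>\<^sup>+v. deg G v \<partial>count_space (verts G \<inter> U)) = edge_count U UNIV G"
proof -
  let ?E = "{(x, y). adj G x y \<and> x \<in> U \<and> y \<in> (UNIV :: plane set)}"
  have row: "(\<integral>\<^sup>+y. indicator ?E (x, y) \<partial>count_space UNIV) = deg G x * indicator (verts G \<inter> U) x" for x
  proof (cases "x \<in> verts G \<inter> U")
    case True
    then have "(\<lambda>y. indicator ?E (x, y) :: ennreal) = indicator (neighbors G x)"
      by (auto simp: fun_eq_iff neighbors_def indicator_def)
    then show ?thesis using True by (simp add: deg_def ncard_def)
  next
    case False
    then have "(\<lambda>y. indicator ?E (x, y) :: ennreal) = (\<lambda>y. 0)"
      using adj_in_verts[OF assms, of x] by (auto simp: fun_eq_iff indicator_def)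
    then show ?thesis using False by simp
  qed
  have "(\<integral>\<^sup>+v. deg G v \<partial>count_space (verts G \<inter> U)) =
      (\<integral>\<^sup>+x. deg G x * indicator (verts G \<inter> U) x \<partial>count_space UNIV)"
    by (cases "verts G \<inter> U = UNIV") (simp_all add: nn_integral_count_space_indicator)
  also have "\<dots> = (\<integral>\<^sup>+x. \<integral>\<^sup>+y. indicator ?E (x, y) \<partial>count_space UNIV \<partial>count_space UNIV)"
    by (simp only: row)
  also have "\<dots> = (\<integral>\<^sup>+e. indicator ?E e \<partial>count_space UNIV)"
    by (rule nn_integral_fst_count_space)
  also have "\<dots> = edge_count U UNIV G"
    by (simp add: edge_count_def ncard_def)
  finally show ?thesis .
qed

lemma Q_subset_unit_boxes:
  "Q (real N) 0 \<subseteq> (\<Union>(a, b)\<in>{..<N} \<times> {..<N}. Q 1 (vec (1 / 2) + (vector [real a, real b] - vec (real N / 2))))"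
proof
  fix x :: plane assume x: "x \<in> Q (real N) 0"
  define a b where "a = nat \<lfloor>x $ 1 + real N / 2\<rfloor>" and "b = nat \<lfloor>x $ 2 + real N / 2\<rfloor>"
  have rng: "0 \<le> x $ 1 + real N / 2" "x $ 1 + real N / 2 < N" "0 \<le> x $ 2 + real N / 2" "x $ 2 + real N / 2 < N"
    using x by (auto simp: mem_Q_iff)
  then have ab: "real a \<le> x $ 1 + real N / 2" "x $ 1 + real N / 2 < real a + 1"
    "real b \<le> x $ 2 + real N / 2" "x $ 2 + real N / 2 < real b + 1"
    unfolding a_def b_def by linarith+
  then have "a < N" "b < N" using rng by linarith+
  moreover have "x \<in> Q 1 (vec (1 / 2) + (vector [real a, real b] - vec (real N / 2)))"
    using ab by (auto simp: mem_Q_iff vector_2)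
  ultimately show "x \<in> (\<Union>(a, b)\<in>{..<N} \<times> {..<N}. Q 1 (vec (1 / 2) + (vector [real a, real b] - vec (real N / 2))))"
    by blast
qed

lemma edge_count_subadditive:
  assumes "finite I" "A \<subseteq> (\<Union>i\<in>I. B i)"
  shows "edge_count A A' G \<le> (\<Sum>i\<in>I. edge_count (B i) A' G)"
proof -
  have "edge_count A A' G \<le> emeasure (count_space UNIV) (\<Union>i\<in>I. {(x, y). adj G x y \<and> x \<in> B i \<and> y \<in> A'})"
    unfolding edge_count_def ncard_def using assms(2) by (intro emeasure_mono) auto
  also have "\<dots> \<le> (\<Sum>i\<in>I. edge_count (B i) A' G)"
    unfolding edge_count_def ncard_def by (intro emeasure_subadditive_finite assms(1)) auto
  finally show ?thesis .
qed

context stationary_graph begin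

lemma AE_eventually_good:
  assumes "\<delta> > 0" "\<And>n. prob (bad K i n 0) \<le> side i n powr - \<delta>"
  shows "AE G in P. \<forall>\<^sub>F n in sequentially. G \<notin> bad K i n 0"
proof -
  have "summable (\<lambda>n. prob (bad K i n 0))"
  proof (rule summable_geometric_powr)
    have "prob (bad K i n 0) \<le> 1 * (2 ^ n) powr - \<delta>" for n
      using assms(2)[of n] powr_mono2'[of "- \<delta>" "2 ^ n" "side i n"] side_ge_power[of n i] assms(1) by simp
    then show "\<forall>\<^sub>F n in sequentially. prob (bad K i n 0) \<le> 1 * (2 ^ n) powr - \<delta>" by simp
  qed (use assms in auto)
  then have "AE G in P. \<forall>\<^sub>F n in sequentially. G \<in> space P - bad K i n 0"
    by (intro borel_cantelli_AE1) (auto simp: bad_events less_top[symmetric])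
  then show ?thesis by (rule AE_mp) (auto elim: eventually_mono)
qed

text \<open>All dyadic boxes are needed, not only those of side \<open>side i n\<close>, because an
  edge that leaves a box may end at any distance. The probabilities are of order
  \<open>(2 ^ j) powr (2 + \<mu>)\<close>, hence summable.\<close>

lemma AE_eventually_no_long_edge:
  assumes "polynomial_long_edges P \<mu>" "\<mu> < -2"
  shows "AE G in P. \<forall>\<^sub>F j in sequentially. \<not> long_edge (Q (2 ^ (j + 1)) 0) (2 ^ j / 16) G"
proof -
  let ?L = "\<lambda>j. {G \<in> space P. long_edge (Q (2 ^ (j + 1)) 0) (2 ^ j / 16) G}"
  have ev: "?L j \<in> events" for j by (simp add: sets_P space_P long_edge_measurable borel_Q)
  obtain C n\<^sub>0 where C: "C \<ge> 0" "\<And>m n. m \<ge> 1 \<Longrightarrow> n \<ge> n\<^sub>0 \<Longrightarrow>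
      prob {G \<in> space P. long_edge (Q m 0) n G} \<le> C * m\<^sup>2 * n powr \<mu>"
    using prob_long_edge[OF assms(1)] by blast
  obtain j\<^sub>0 where j\<^sub>0: "16 * n\<^sub>0 < 2 ^ j\<^sub>0" using real_arch_pow[of 2 "16 * n\<^sub>0"] by auto
  have "prob (?L j) \<le> 4 * C * (1 / 16) powr \<mu> * (2 ^ j) powr (2 + \<mu>)" if "j \<ge> j\<^sub>0" for j
  proof -
    have "(2 :: real) ^ j\<^sub>0 \<le> 2 ^ j" using that by (intro power_increasing) auto
    then have "prob (?L j) \<le> C * (2 ^ (j + 1))\<^sup>2 * (2 ^ j / 16) powr \<mu>"
      using j\<^sub>0 by (intro C(2) one_le_power) linarith+
    also have "(2 ^ j / 16) powr \<mu> = (2 ^ j) powr \<mu> * (1 / 16) powr \<mu>"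
      using powr_mult[of "2 ^ j" "1 / 16" \<mu>] by simp
    also have "C * (2 ^ (j + 1))\<^sup>2 * ((2 ^ j) powr \<mu> * (1 / 16) powr \<mu>) =
        4 * C * (1 / 16) powr \<mu> * ((2 ^ j)\<^sup>2 * (2 ^ j) powr \<mu>)"
      by (simp add: power_mult_distrib)
    also have "(2 ^ j :: real)\<^sup>2 * (2 ^ j) powr \<mu> = (2 ^ j) powr (2 + \<mu>)"
      unfolding powr_add by (subst powr_numeral) auto
    finally show ?thesis .
  qed
  then have "summable (\<lambda>j. prob (?L j))"
    using assms(2) by (intro summable_geometric_powr[where s = "2 + \<mu>"])
      (auto simp: eventually_sequentially)
  then have "AE G in P. \<forall>\<^sub>F j in sequentially. G \<in> space P - ?L j"
    using ev by (intro borel_cantelli_AE1) (auto simp: less_top[symmetric])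
  then show ?thesis by (rule AE_mp) (auto elim: eventually_mono)
qed

lemma edge_count_measurable_P: "A \<in> sets borel \<Longrightarrow> A' \<in> sets borel \<Longrightarrow> edge_count A A' \<in> borel_measurable P"
  using edge_count_measurable[of A A' K] by (simp add: measurable_cong_sets[OF sets_P refl])

lemma nn_integral_edge_count_unit_box:
  "(\<integral>\<^sup>+G. edge_count (Q 1 (vec (1 / 2) + t)) UNIV G \<partial>P) = degree_intensity P"
proof -
  have unit: "{x. \<forall>i. 0 \<le> x $ i \<and> x $ i < 1} = Q 1 (vec (1 / 2))"
    by (auto simp: Q_def)
  have "edge_count (Q 1 (vec (1 / 2) + t)) UNIV (translate t G) = edge_count (Q 1 (vec (1 / 2))) UNIV G" for G :: "'m geo_graph"
  proof -
    have "(\<lambda>x. x + t) -` Q 1 (vec (1 / 2) + t) = Q 1 (vec (1 / 2))" by (auto simp: mem_Q_translate)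
    then show ?thesis by (simp add: edge_count_translate)
  qed
  then have "(\<integral>\<^sup>+G. edge_count (Q 1 (vec (1 / 2) + t)) UNIV G \<partial>P) = (\<integral>\<^sup>+G. edge_count (Q 1 (vec (1 / 2))) UNIV G \<partial>P)"
    using nn_integral_translate[of "edge_count (Q 1 (vec (1 / 2) + t)) UNIV" t] by (simp add: edge_count_measurable_P borel_Q)
  also have "\<dots> = degree_intensity P"
    unfolding degree_intensity_def unit by (intro nn_integral_cong) (simp add: nn_integral_deg space_P)
  finally show ?thesis .
qed

lemma nn_integral_edge_count_le:
  "(\<integral>\<^sup>+G. edge_count (Q (real N) 0) UNIV G \<partial>P) \<le> of_nat (N\<^sup>2) * degree_intensity P"
proof -
  let ?I = "{..<N} \<times> {..<N}"
  let ?B = "\<lambda>e. Q 1 (vec (1 / 2) + (vector [real (fst e), real (snd e)] - vec (real N / 2)))"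
  have "Q (real N) 0 \<subseteq> (\<Union>e\<in>?I. ?B e)"
    using Q_subset_unit_boxes[of N] by (simp add: case_prod_beta')
  then have "(\<integral>\<^sup>+G. edge_count (Q (real N) 0) UNIV G \<partial>P) \<le> (\<integral>\<^sup>+G. (\<Sum>e\<in>?I. edge_count (?B e) UNIV G) \<partial>P)"
    by (intro nn_integral_mono edge_count_subadditive) auto
  also have "\<dots> = (\<Sum>e\<in>?I. \<integral>\<^sup>+G. edge_count (?B e) UNIV G \<partial>P)"
    by (intro nn_integral_sum edge_count_measurable_P borel_Q) auto
  also have "\<dots> = of_nat (N\<^sup>2) * degree_intensity P"
    by (simp add: nn_integral_edge_count_unit_box power2_eq_square)
  finally show ?thesis .
qed

text \<open>By Fatou's lemma; a bound along a random subsequence of scales is all that is needed.\<close>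

lemma AE_frequently_edge_count_le:
  assumes "degree_intensity P < \<infinity>"
  shows "AE G in P. \<exists>C\<ge>0. \<exists>\<^sub>F n in sequentially. edge_count (Q (side i n) 0) UNIV G \<le> ennreal (C * (side i n)\<^sup>2)"
proof -
  define Y where "Y n G = ennreal (1 / (side i n)\<^sup>2) * edge_count (Q (side i n) 0) UNIV G" for n and G :: "'m geo_graph"
  have [measurable]: "Y n \<in> borel_measurable P" for n
    using edge_count_measurable_P[OF borel_Q, of UNIV] unfolding Y_def by measurable
  have "(\<integral>\<^sup>+G. Y n G \<partial>P) \<le> degree_intensity P" for n
  proof -
    have N: "side i n = real (3 ^ i * 2 ^ side_exp n)" by (simp add: side_def)
    have "(\<integral>\<^sup>+G. Y n G \<partial>P) = ennreal (1 / (side i n)\<^sup>2) * (\<integral>\<^sup>+G. edge_count (Q (side i n) 0) UNIV G \<partial>P)"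
      unfolding Y_def by (intro nn_integral_cmult edge_count_measurable_P borel_Q) auto
    also have "\<dots> \<le> ennreal (1 / (side i n)\<^sup>2) * (of_nat ((3 ^ i * 2 ^ side_exp n)\<^sup>2) * degree_intensity P)"
      unfolding N by (intro mult_left_mono nn_integral_edge_count_le) auto
    also have "of_nat ((3 ^ i * 2 ^ side_exp n)\<^sup>2) = ennreal ((side i n)\<^sup>2)"
      unfolding N by (simp only: ennreal_of_nat_eq_real_of_nat of_nat_power)
    also have "ennreal (1 / (side i n)\<^sup>2) * (ennreal ((side i n)\<^sup>2) * degree_intensity P) = degree_intensity P"
      using side_pos[of i n] by (simp add: mult.assoc[symmetric] ennreal_mult[symmetric])
    finally show ?thesis .
  qed
  then have "liminf (\<lambda>n. \<integral>\<^sup>+G. Y n G \<partial>P) \<le> liminf (\<lambda>n. degree_intensity P)"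
    by (intro Liminf_mono) auto
  also have "\<dots> = degree_intensity P" by (simp add: Liminf_const)
  finally have "(\<integral>\<^sup>+G. liminf (\<lambda>n. Y n G) \<partial>P) \<noteq> \<infinity>"
    using nn_integral_liminf[of Y P] assms by (auto simp: top_unique)
  then have "AE G in P. liminf (\<lambda>n. Y n G) \<noteq> \<infinity>"
    by (intro nn_integral_PInf_AE) auto
  then show ?thesis
  proof (rule AE_mp, intro AE_I2 impI)
    fix G assume fin: "liminf (\<lambda>n. Y n G) \<noteq> \<infinity>"
    then have "\<not> \<infinity> \<le> liminf (\<lambda>n. Y n G)" by (simp add: top_unique)
    then obtain y where y: "y < \<infinity>" "\<exists>\<^sub>F n in sequentially. Y n G \<le> y"
      unfolding le_Liminf_iff by (auto simp: frequently_def not_le)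
    then obtain C where C: "y = ennreal C" "C \<ge> 0" by (cases y) auto
    have "edge_count (Q (side i n) 0) UNIV G \<le> ennreal (C * (side i n)\<^sup>2)" if "Y n G \<le> y" for n
    proof -
      have "edge_count (Q (side i n) 0) UNIV G = ennreal ((side i n)\<^sup>2) * Y n G"
        using side_pos[of i n] by (simp add: Y_def mult.assoc[symmetric] ennreal_mult[symmetric])
      also have "\<dots> \<le> ennreal ((side i n)\<^sup>2) * ennreal C" using that C by (intro mult_left_mono) auto
      finally show ?thesis using C by (simp add: ennreal_mult[symmetric] mult.commute)
    qed
    with y(2) show "\<exists>C\<ge>0. \<exists>\<^sub>F n in sequentially. edge_count (Q (side i n) 0) UNIV G \<le> ennreal (C * (side i n)\<^sup>2)"
      using C(2) by (intro exI[of _ C]) (auto elim: frequently_elim1)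
  qed
qed

end

section \<open>Cutoff functions\<close>

definition reaches :: "'m geo_graph \<Rightarrow> plane set \<Rightarrow> plane set \<Rightarrow> plane \<Rightarrow> nat \<Rightarrow> bool" where
  "reaches G B A x k \<longleftrightarrow> (\<exists>p. walk G B k p \<and> p 0 \<in> A \<and> p k = x)"

text \<open>One minus the graph distance to \<open>A\<close> inside \<open>B\<close> in units of
  \<open>L\<close>, truncated at 0. Points that no walk inside \<open>B\<close> joins to
  \<open>A\<close> count as infinitely far away.\<close>

definition cutoff :: "'m geo_graph \<Rightarrow> plane set \<Rightarrow> plane set \<Rightarrow> real \<Rightarrow> plane \<Rightarrow> real" where
  "cutoff G B A L x =
     (if \<exists>k. reaches G B A x k then max 0 (1 - real (LEAST k. reaches G B A x k) / L) else 0)"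

lemma cutoff_eq_1:
  assumes "x \<in> A" "A \<subseteq> B"
  shows "cutoff G B A L x = 1"
proof -
  have r: "reaches G B A x 0" unfolding reaches_def walk_def using assms by (intro exI[of _ "\<lambda>_. x"]) auto
  then have "(LEAST k. reaches G B A x k) = 0" by simp
  with r show ?thesis unfolding cutoff_def by auto
qed

lemma cutoff_nonzero:
  assumes "cutoff G B A L x \<noteq> 0" "L > 0"
  obtains k p where "walk G B k p" "p 0 \<in> A" "p k = x" "real k < L"
proof -
  have ex: "\<exists>k. reaches G B A x k" using assms(1) by (auto simp: cutoff_def split: if_splits)
  then have "max 0 (1 - real (LEAST k. reaches G B A x k) / L) \<noteq> 0"
    using assms(1) by (simp only: cutoff_def if_True simp_thms)
  then have l: "1 - real (LEAST k. reaches G B A x k) / L > 0" by linarith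
  have "reaches G B A x (LEAST k. reaches G B A x k)" using ex by (rule LeastI_ex)
  moreover have "real (LEAST k. reaches G B A x k) < L" using l assms(2) by (simp add: field_simps)
  ultimately show ?thesis using that unfolding reaches_def by blast
qed

lemma cutoff_outside: "x \<notin> B \<Longrightarrow> cutoff G B A L x = 0"
  by (auto simp: cutoff_def reaches_def walk_def)

lemma reaches_step:
  assumes "reaches G B A x k" "adj G x y" "y \<in> B"
  shows "reaches G B A y (Suc k)"
proof -
  obtain p where p: "walk G B k p" "p 0 \<in> A" "p k = x" using assms(1) by (auto simp: reaches_def)
  have "walk G B (Suc k) (p(Suc k := y))"
    using p assms unfolding walk_def by (auto simp: less_Suc_eq le_Suc_eq)
  then show ?thesis unfolding reaches_def using p by (intro exI[of _ "p(Suc k := y)"]) auto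
qed

text \<open>Inside \<open>B\<close>, a neighbour of a reached point is reached at most one step
  later, so the default value 0 of unreached points causes no jump.\<close>

lemma cutoff_lipschitz:
  assumes "adj G x y" "x \<in> B" "y \<in> B" "L > 0"
  shows "\<bar>cutoff G B A L x - cutoff G B A L y\<bar> \<le> 1 / L"
proof -
  have one: "cutoff G B A L x - cutoff G B A L y \<le> 1 / L" if "adj G x y" "x \<in> B" "y \<in> B" for x y
  proof (cases "\<exists>k. reaches G B A x k")
    case True
    let ?k = "LEAST k. reaches G B A x k" and ?l = "LEAST k. reaches G B A y k"
    have r: "reaches G B A y (Suc ?k)" using LeastI_ex[OF True] that by (intro reaches_step)
    then have "?l \<le> Suc ?k" by (rule Least_le)
    then have "real ?l / L \<le> real ?k / L + 1 / L"
      using assms(4) unfolding add_divide_distrib[symmetric] by (intro divide_right_mono) auto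
    moreover have "1 / L > 0" using assms(4) by simp
    moreover have "cutoff G B A L x = max 0 (1 - real ?k / L)" "cutoff G B A L y = max 0 (1 - real ?l / L)"
      using True r by (auto simp: cutoff_def)
    ultimately show ?thesis by linarith
  next
    case False
    then have "cutoff G B A L x = 0" by (simp only: cutoff_def if_False)
    moreover have "cutoff G B A L y \<ge> 0" by (simp add: cutoff_def)
    moreover have "1 / L > 0" using assms(4) by simp
    ultimately show ?thesis by linarith
  qed
  show ?thesis using one[of x y] one[of y x] assms adj_sym[of G x y] by auto
qed

lemma Q_subset: "m \<le> m' \<Longrightarrow> Q m z \<subseteq> Q m' z"
  unfolding subset_iff mem_Q_iff by auto

section \<open>Recurrence from good scales\<close>

text \<open>Let \<open>r\<close> be the sup norm of an endpoint \<open>y\<close> outside the box and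
  choose \<open>j\<close> with \<open>2 ^ j / 2\<close> \<le> \<open>r\<close> <
  \<open>2 ^ j\<close>. The other endpoint has sup norm at most \<open>3 / 4 * r\<close>, so the
  edge has length at least \<open>r / 4\<close> and is a forbidden long edge of the box of side
  \<open>2 ^ (j + 1)\<close>.\<close>

lemma no_edge_leaves_box:
  assumes short: "\<And>j. j \<ge> j\<^sub>0 \<Longrightarrow> \<not> long_edge (Q (2 ^ (j + 1)) 0) (2 ^ j / 16) G"
    and M: "M / 2 \<ge> 2 ^ j\<^sub>0" and x: "x \<in> Q (3 * M / 4) 0" and xy: "adj G x y"
  shows "y \<in> Q M 0"
proof (rule ccontr)
  assume "y \<notin> Q M 0"
  define r where "r = max \<bar>y $ 1\<bar> \<bar>y $ 2\<bar>"
  have r: "r \<ge> M / 2" using \<open>y \<notin> Q M 0\<close> by (auto simp: mem_Q_iff r_def)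
  have xr: "\<bar>x $ k\<bar> \<le> 3 / 4 * r" for k
  proof -
    have "\<bar>x $ k\<bar> \<le> 3 * M / 8" using x unfolding Q_def by (auto dest!: spec[of _ k])
    then show ?thesis using r by simp
  qed
  obtain l where "r < 2 ^ l" using real_arch_pow[of 2 r] by auto
  define j where "j = (LEAST l. r < 2 ^ l)"
  have j: "r < 2 ^ j" unfolding j_def by (rule LeastI[of _ l]) fact
  have "j > j\<^sub>0"
  proof (rule ccontr)
    assume "\<not> j > j\<^sub>0"
    then have "(2 :: real) ^ j \<le> 2 ^ j\<^sub>0" by (intro power_increasing) auto
    then show False using j r M by linarith
  qed
  then obtain j' where j': "j = Suc j'" by (cases j) auto
  then have "\<not> r < 2 ^ j'" using not_less_Least[of j' "\<lambda>l. r < 2 ^ l"] unfolding j_def by simp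
  then have low: "r \<ge> 2 ^ j / 2" by (simp add: j')
  have "r > 0" using low by (smt (verit) half_gt_zero zero_less_power)
  have "norm (x - y) \<ge> r / 4"
  proof -
    obtain k where k: "r = \<bar>y $ k\<bar>" unfolding r_def by (metis max_def)
    have "r - 3 / 4 * r \<le> \<bar>(x - y) $ k\<bar>" using xr[of k] k by (auto simp: abs_if split: if_splits)
    then show ?thesis using component_le_norm_cart[of "x - y" k] by simp
  qed
  then have "norm (x - y) > 2 ^ j / 16" using low zero_less_power[of "2 :: real" j] by linarith
  moreover have "\<bar>x $ k\<bar> < 2 ^ j" for k using xr[of k] j \<open>r > 0\<close> by simp
  then have "x \<in> Q (2 ^ (j + 1)) 0" unfolding Q_def by (auto simp: abs_less_iff intro: less_imp_le) (smt (verit))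
  moreover have "y \<in> Q (2 ^ (j + 1)) 0" using j unfolding mem_Q_iff r_def by auto
  ultimately have "long_edge (Q (2 ^ (j + 1)) 0) (2 ^ j / 16) G" unfolding long_edge_def using xy by blast
  with short[of j] \<open>j > j\<^sub>0\<close> show False by simp
qed

lemma component_subset_verts:
  assumes "G \<in> space (graph_space K)" "a \<in> verts G"
  shows "component G a \<subseteq> verts G"
proof
  fix y assume "y \<in> component G a"
  then have "(a, y) \<in> {(a, b). adj G a b}\<^sup>*" by (simp add: component_def)
  then show "y \<in> verts G" by induction (use assms adj_in_verts in auto)
qed

text \<open>In a good box, fewer than \<open>1 / (2 * side i 0) * (side i n / 8)\<close> steps
  cannot produce a displacement of \<open>side i n / 8\<close>; this fixes the length
  \<open>L\<close>. From the half box, of half-side a quarter, such walks stay within three eighths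
  of the side from the centre in each coordinate.\<close>

lemma cutoff_support:
  assumes "G \<in> space (graph_space K)" "G \<notin> bad K i n 0"
    and "cutoff G (Q (side i n) 0) (Q (side i n / 2) 0) (side i n / (16 * side i 0)) x \<noteq> 0"
  shows "x \<in> Q (3 * side i n / 4) 0"
proof -
  let ?m = "side i n" and ?L = "side i n / (16 * side i 0)"
  have pos: "?m > 0" "side i 0 > 0" by (auto simp: side_pos)
  obtain k p where p: "walk G (Q ?m 0) k p" "p 0 \<in> Q (?m / 2) 0" "p k = x" "real k < ?L"
    by (rule cutoff_nonzero[OF assms(3)]) (use pos in auto)
  have "norm (p k - p 0) < ?m / 8"
  proof (rule ccontr)
    assume *: "\<not> norm (p k - p 0) < ?m / 8"
    have "?L = 1 / (2 * side i 0) * (?m / 8)" by simp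
    also have "\<dots> \<le> speed i n * norm (p k - p 0)"
      using * pos speed_lower[of i n] by (intro mult_mono) (auto intro: order_trans[OF _ speed_lower])
    also have "\<dots> \<le> real k" using good_walk_length[OF assms(1,2) p(1)] * by simp
    finally show False using p(4) by simp
  qed
  then have "\<bar>(x - p 0) $ l\<bar> < ?m / 8" for l
    using component_le_norm_cart[of "x - p 0" l] unfolding p(3) by linarith
  from this[of 1] this[of 2] p(2) show ?thesis
    unfolding mem_Q_iff zero_index vector_minus_component by safe linarith+
qed

text \<open>The cutoff at scale \<open>n\<close> varies on \<open>O((side i n)\<^sup>2)\<close>
  edges, by at most \<open>1 / L n\<close> on each, so its energy is bounded uniformly in
  \<open>n\<close>. It varies only inside \<open>Q (side i n) 0\<close>, where the cutoffs of all
  later scales are 1; this makes the edge sets disjoint.\<close>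

lemma recurrent_if_frequently_good:
  assumes G: "G \<in> space (graph_space K)" "locally_finite G"
    and good: "\<forall>\<^sub>F n in sequentially. G \<notin> bad K i n 0"
    and short: "\<forall>\<^sub>F j in sequentially. \<not> long_edge (Q (2 ^ (j + 1)) 0) (2 ^ j / 16) G"
    and count: "\<exists>\<^sub>F n in sequentially. edge_count (Q (side i n) 0) UNIV G \<le> ennreal (C * (side i n)\<^sup>2)"
    and "C \<ge> 0"
    and a: "a \<in> verts G" "infinite (component G a)"
  shows "eff_resistance_to_inf G a = \<infinity>"
proof -
  define L where "L n = side i n / (16 * side i 0)" for n
  define f where "f n = cutoff G (Q (side i n) 0) (Q (side i n / 2) 0) (L n)" for n
  have L: "L n > 0" for n using side_pos by (simp add: L_def)
  obtain j\<^sub>0 where j\<^sub>0: "\<And>j. j \<ge> j\<^sub>0 \<Longrightarrow> \<not> long_edge (Q (2 ^ (j + 1)) 0) (2 ^ j / 16) G"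
    using short unfolding eventually_sequentially by blast
  \<comment> \<open>The two lower bounds put \<open>a\<close> into the half box and make the box
    large enough for \<open>no_edge_leaves_box\<close>.\<close>
  obtain l where l: "max (4 * norm a) (2 * 2 ^ j\<^sub>0) < (2 :: real) ^ l" 
    using real_arch_pow[of 2 "max (4 * norm a) (2 * 2 ^ j\<^sub>0)"] by auto
  define I where "I = {n. G \<notin> bad K i n 0 \<and> l \<le> n \<and>
      edge_count (Q (side i n) 0) UNIV G \<le> ennreal (C * (side i n)\<^sup>2)}"
  have "\<exists>\<^sub>F n in sequentially. n \<in> I"
    using frequently_eventually_frequently[OF count eventually_conj[OF good eventually_ge_at_top[of l]]]
    by (rule frequently_elim1) (auto simp: I_def)
  then have I: "infinite I" by (simp add: cofinite_eq_sequentially[symmetric] frequently_cofinite)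
  have large: "4 * norm a < side i n" "2 ^ j\<^sub>0 \<le> side i n / 2" if "n \<in> I" for n
  proof -
    have "(2 :: real) ^ l \<le> 2 ^ n" using that by (intro power_increasing) (auto simp: I_def)
    also have "\<dots> \<le> side i n" by (rule side_ge_power)
    finally show "4 * norm a < side i n" "2 ^ j\<^sub>0 \<le> side i n / 2" using l by auto
  qed
  let ?D = "\<lambda>n. {(x, y). adj G x y \<and> f n x \<noteq> f n y}"
  \<comment> \<open>One endpoint lies in the support of the cutoff, hence in the box of three
    quarters of the side, and no edge jumps from there out of the full box.\<close>
  have D_box: "x \<in> Q (side i n) 0 \<and> y \<in> Q (side i n) 0" if n: "n \<in> I" and xy: "(x, y) \<in> ?D n" for n x y
  proof -
    have supp: "z \<in> Q (3 * side i n / 4) 0 \<and> z \<in> Q (side i n) 0" if "f n z \<noteq> 0" for z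
    proof -
      have "z \<in> Q (3 * side i n / 4) 0"
        using cutoff_support[OF G(1), of i n z] n that by (simp add: I_def f_def L_def)
      then show ?thesis using Q_subset[of "3 * side i n / 4" "side i n"] side_pos[of i n] by auto
    qed
    note leave = no_edge_leaves_box[OF j\<^sub>0 large(2)[OF n]]
    from xy consider "f n x \<noteq> 0" | "f n y \<noteq> 0" by force
    then show ?thesis
      by cases (use xy supp leave adj_sym in \<open>blast+\<close>)
  qed
  have card_D: "finite (?D n) \<and> real (card (?D n)) \<le> C * (side i n)\<^sup>2" if n: "n \<in> I" for n
  proof -
    have "emeasure (count_space UNIV) (?D n) \<le> edge_count (Q (side i n) 0) UNIV G"
      unfolding edge_count_def ncard_def using D_box[OF n] by (intro emeasure_mono) auto
    also have "\<dots> \<le> ennreal (C * (side i n)\<^sup>2)" using n by (simp add: I_def)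
    finally have le: "emeasure (count_space UNIV) (?D n) \<le> ennreal (C * (side i n)\<^sup>2)" .
    then have fin: "finite (?D n)"
      by (cases "finite (?D n)") (auto simp: emeasure_count_space top_unique)
    then have "ennreal (real (card (?D n))) \<le> ennreal (C * (side i n)\<^sup>2)"
      using le by (simp add: emeasure_count_space ennreal_of_nat_eq_real_of_nat)
    then show ?thesis using fin \<open>C \<ge> 0\<close> by simp
  qed
  show ?thesis
  proof (rule eff_resistance_to_inf_eq_infinity[where f = f and I = I and B = "256 * C * (side i 0)\<^sup>2"])
    show "finite (neighbors G x)" if "x \<in> component G a" for x
      using that G(2) component_subset_verts[OF G(1) a(1)] by (auto simp: locally_finite_def)
    show "f n a = 1" if "n \<in> I" for n
      unfolding f_def
    proof (rule cutoff_eq_1)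
      show "Q (side i n / 2) 0 \<subseteq> Q (side i n) (0 :: plane)"
        by (rule Q_subset) (use side_pos[of i n] in auto)
      have "\<bar>a $ k\<bar> < side i n / 4" for k
        using component_le_norm_cart[of a k] large(1)[OF that] by linarith
      from this[of 1] this[of 2] show "a \<in> Q (side i n / 2) 0" by (auto simp: mem_Q_iff)
    qed
    show "finite {x \<in> component G a. f n x \<noteq> 0}" for n
    proof (rule finite_subset)
      show "{x \<in> component G a. f n x \<noteq> 0} \<subseteq> verts G \<inter> cball 0 (side i n)"
      proof safe
        fix x assume "x \<in> component G a" "f n x \<noteq> 0"
        then show "x \<in> verts G" using component_subset_verts[OF G(1) a(1)] by blast
        have "x \<in> Q (side i n) 0" using \<open>f n x \<noteq> 0\<close> cutoff_outside unfolding f_def by blast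
        then show "x \<in> cball 0 (side i n)" using norm_le_of_mem_Q[of x "side i n" 0] by simp
      qed
      show "finite (verts G \<inter> cball 0 (side i n))"
        using G(2) unfolding locally_finite_def by (simp add: compact_cball)
    qed
    show "finite (?D n)" if "n \<in> I" for n using card_D[OF that] by blast
    show "(\<Sum>(x, y)\<in>?D n. (f n x - f n y)\<^sup>2) \<le> 256 * C * (side i 0)\<^sup>2" if n: "n \<in> I" for n
    proof -
      have "(\<Sum>(x, y)\<in>?D n. (f n x - f n y)\<^sup>2) \<le> (\<Sum>e\<in>?D n. (1 / L n)\<^sup>2)"
      proof (rule sum_mono)
        fix e assume "e \<in> ?D n"
        then obtain x y where e: "e = (x, y)" "(x, y) \<in> ?D n" by blast
        have "x \<in> Q (side i n) 0 \<and> y \<in> Q (side i n) 0" using D_box[OF n e(2)] .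
        then have "\<bar>f n x - f n y\<bar> \<le> 1 / L n"
          unfolding f_def using e(2) L by (intro cutoff_lipschitz) auto
        then have "\<bar>f n x - f n y\<bar>\<^sup>2 \<le> (1 / L n)\<^sup>2" by (intro power_mono) auto
        then show "(case e of (x, y) \<Rightarrow> (f n x - f n y)\<^sup>2) \<le> (1 / L n)\<^sup>2" using e by simp
      qed
      also have "\<dots> = real (card (?D n)) * (1 / L n)\<^sup>2" by simp
      also have "\<dots> \<le> (C * (side i n)\<^sup>2) * (1 / L n)\<^sup>2"
        using card_D[OF n] by (intro mult_right_mono) auto
      also have "\<dots> = 256 * C * (side i 0)\<^sup>2"
        using side_pos[of i n] side_pos[of i 0] by (simp add: L_def field_simps power2_eq_square)
      finally show ?thesis .
    qed
    have disj: "?D n \<inter> ?D n' = {}" if "n \<in> I" "n' \<in> I" "n < n'" for n n'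
    proof -
      have "2 * side i n \<le> side i (Suc n)"
      proof -
        have "(2 :: real) ^ 1 \<le> 2 ^ (n + 8)" by (rule power_increasing) auto
        then show ?thesis unfolding side_Suc using side_pos[of i n] by (intro mult_right_mono) auto
      qed
      also have "\<dots> \<le> side i n'"
        unfolding side_def using that(3) strict_mono_less_eq[OF strict_mono_side_exp, of "Suc n" n']
        by (intro mult_left_mono power_increasing) auto
      finally have sub: "Q (side i n) 0 \<subseteq> Q (side i n' / 2) (0 :: plane)" by (intro Q_subset) simp
      have "Q (side i n' / 2) 0 \<subseteq> Q (side i n') (0 :: plane)"
        by (rule Q_subset) (use side_pos[of i n'] in auto)
      then have one: "f n' x = 1" if "x \<in> Q (side i n) 0" for x
        unfolding f_def using that sub by (intro cutoff_eq_1) auto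
      show ?thesis
      proof (intro equals0I)
        fix e assume "e \<in> ?D n \<inter> ?D n'"
        moreover obtain x y where "e = (x, y)" by (cases e)
        ultimately have xy: "(x, y) \<in> ?D n" "f n' x \<noteq> f n' y" by auto
        have "x \<in> Q (side i n) 0 \<and> y \<in> Q (side i n) 0" by (rule D_box[OF that(1) xy(1)])
        then show False using one[of x] one[of y] xy(2) by simp
      qed
    qed
    show "?D n \<inter> ?D n' = {}" if "n \<in> I" "n' \<in> I" "n \<noteq> n'" for n n'
    proof (cases "n < n'")
      case True
      show ?thesis by (rule disj[OF that(1,2) True])
    next
      case False
      then have "n' < n" using that(3) by simp
      then show ?thesis by (subst Int_commute) (rule disj[OF that(2,1)])
    qed
  qed (use I a in auto)
qed

theorem theorem2p5:
  fixes M :: "'w measure" and K :: "'m measure" and G :: "'w \<Rightarrow> 'm geo_graph"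
    and \<xi> \<mu> :: real
  assumes "prob_space M"
    and "G \<in> measurable M (graph_space K)"
    and "AE w in M. locally_finite (G w)"
    and "stationary (law M K G)"
    and "ergodic (law M K G)"
    and "polynomial_mixing K (law M K G) \<xi>" and "\<xi> < 0"
    and "polynomial_long_edges (law M K G) \<mu>" and "\<mu> < -2"
    and "degree_intensity (law M K G) < \<infinity>"
  shows "AE w in M. \<forall>C\<in>components_of (G w). recurrent_component (G w) C"
proof -
  interpret M: prob_space M by fact
  interpret stationary_graph "law M K G" K
  proof -
    interpret prob_space "law M K G" using assms(2) by (rule M.prob_space_distr)
    show "stationary_graph (law M K G) K" by unfold_locales (use assms(4) in auto)
  qed
  \<comment> \<open>The base side \<open>3 ^ i\<close> is fixed from here on, for all graphs at
    once; only the edge-count constant remains random.\<close>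
  obtain \<delta> i where \<delta>: "\<delta> > 0" "\<And>n. prob (bad K i n 0) \<le> side i n powr - \<delta>"
    using prob_bad_decay[OF assms(6-9)] by blast
  have "AE w in M. \<forall>\<^sub>F n in sequentially. G w \<notin> bad K i n 0"
    using AE_eventually_good[OF \<delta>] by (rule AE_distrD[OF assms(2)])
  moreover have "AE w in M. \<forall>\<^sub>F j in sequentially. \<not> long_edge (Q (2 ^ (j + 1)) 0) (2 ^ j / 16) (G w)"
    using AE_eventually_no_long_edge[OF assms(8,9)] by (rule AE_distrD[OF assms(2)])
  moreover have "AE w in M. \<exists>C\<ge>0. \<exists>\<^sub>F n in sequentially.
      edge_count (Q (side i n) 0) UNIV (G w) \<le> ennreal (C * (side i n)\<^sup>2)"
    using AE_frequently_edge_count_le[OF assms(10)] by (rule AE_distrD[OF assms(2)])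
  moreover have "AE w in M. w \<in> space M" by simp
  ultimately show ?thesis
    using assms(3)
  proof eventually_elim
    case (elim w)
    have G: "G w \<in> space (graph_space K)" using assms(2) elim(4) by (rule measurable_space)
    show ?case
    proof (intro ballI)
      fix C assume "C \<in> components_of (G w)"
      then obtain x where x: "x \<in> verts (G w)" "C = component (G w) x" by (auto simp: components_of_def)
      have "eff_resistance_to_inf (G w) a = \<infinity>" if "infinite C" "a \<in> C" for a
      proof -
        have "a \<in> verts (G w)" "component (G w) a = C"
          using that component_subset_verts[OF G x(1)] component_eq[of a "G w" x] x(2) by auto
        then show ?thesis
          using elim G that recurrent_if_frequently_good[OF G] by auto
      qed
      then show "recurrent_component (G w) C" unfolding recurrent_component_def by blast
    qed
  qed
qed

end
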